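(* Let $(\mathbf P_M^n,\mathbf Q_M^n,\mathbf U_M^n,\mathbf V_M^n)_{0\le n\le N}$ be given by the sine pseudo-spectral fully-discrete scheme, for $n=1,\dots,N$, $$\begin{aligned}\mathbf P_M^n=\;&\mathbf P_M^{n-1}-\Delta t\Big(\tilde{\mathbf A}\tfrac{\mathbf Q_M^n+\mathbf Q_M^{n-1}}2+\tfrac12\mathbf U_M^n\cdot(\mathbf Q_M^n+\mathbf Q_M^{n-1})\Big)+C_1\boldsymbol\eta_1\Delta B_1^n+\tfrac12\Delta t\,C_1\Delta B_0^n(\tilde{\mathbf A}\boldsymbol\eta_1+\mathbf U_M^n\cdot\boldsymbol\eta_1),\\ \mathbf Q_M^n=\;&\mathbf Q_M^{n-1}+\Delta t\Big(\tilde{\mathbf A}\tfrac{\mathbf P_M^n+\mathbf P_M^{n-1}}2+\tfrac12\mathbf U_M^n\cdot(\mathbf P_M^n+\mathbf P_M^{n-1})\Big)-C_1\boldsymbol\eta_1\Delta B_0^n+\tfrac12\Delta t\,C_1\Delta B_1^n(\tilde{\mathbf A}\boldsymbol\eta_1+\mathbf U_M^n\cdot\boldsymbol\eta_1),\\ \mathbf V_M^n=\;&\mathbf V_M^{n-1}+\tfrac12\Delta t\Big(\tilde{\mathbf A}\tfrac{\mathbf U_M^n+\mathbf U_M^{n-1}}2-\tfrac{\mathbf U_M^n+\mathbf U_M^{n-1}}2+\mathbf P_M^{n-1}\cdot\mathbf P_M^{n-1}+\mathbf Q_M^{n-1}\cdot\mathbf Q_M^{n-1}\Big)+\tfrac12C_2\boldsymbol\eta_2\Delta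 B_2^n\\&+\Delta t\big(C_1\mathbf P_M^{n-1}\cdot\boldsymbol\eta_1\Delta B_1^n-C_1\mathbf Q_M^{n-1}\cdot\boldsymbol\eta_1\Delta B_0^n+\Delta t\,C_1^2\boldsymbol\eta_1\cdot\boldsymbol\eta_1\big),\\ \mathbf U_M^n=\;&\mathbf U_M^{n-1}+\Delta t(\mathbf V_M^n+\mathbf V_M^{n-1})+\tfrac12\Delta t\,C_2\boldsymbol\eta_2\Delta B_2^n.\end{aligned}$$ Then for every $n\in\{0,1,\dots,N\}$ the scheme satisfies the averaged charge evolution law $$\mathbb{E}[\mathcal N(\mathbf P_M^n,\mathbf Q_M^n)]=\mathbb{E}[\mathcal N(\mathbf P_M^0,\mathbf Q_M^0)]+2C_1^2\|\boldsymbol\eta_1\|_h^2\,t_n$$ and the averaged energy evolution law $$\mathbb{E}[\overline{\mathcal H}(\mathbf P_M^n,\mathbf Q_M^n,\mathbf U_M^n,\mathbf V_M^n)]=\mathbb{E}[\overline{\mathcal H}(\mathbf P_M^0,\mathbf Q_M^0,\mathbf U_M^0,\mathbf V_M^0)]-C_2^2\mathcal Q_2t_n+4C_1^2\langle\boldsymbol\eta_1,\tilde{\mathbf A}\boldsymbol\eta_1\rangle_h\,t_n+4C_1^2\sum_{i=0}^{n-1}\mathbb{E}[\langle\mathbf U_M^i,\boldsymbol\eta_1\cdot\boldsymbol\eta_1\rangle_h]\,\Delta t,$$ where $\mathcal N(\mathbf P,\mathbf Q)=\|\mathbf P\|_h^2+\|\mathbf Q\|_h^2$, $\mathcal Q_2=\|\boldsymbol\eta_2\|_h^2$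 and $$\overline{\mathcal H}(\mathbf P,\mathbf Q,\mathbf U,\mathbf V)=2\langle\mathbf U,\mathbf P\cdot\mathbf P+\mathbf Q\cdot\mathbf Q\rangle_h-\|\mathbf U\|_h^2-4\|\mathbf V\|_h^2+\langle\mathbf U,\tilde{\mathbf A}\mathbf U\rangle_h+2\langle\mathbf P,\tilde{\mathbf A}\mathbf P\rangle_h+2\langle\mathbf Q,\tilde{\mathbf A}\mathbf Q\rangle_h.$$
   Context: $C_1,C_2\in\mathbb{R}$; $B_0,B_1,B_2$ are independent standard real Wiener processes; $\eta_1,\eta_2$ are sufficiently smooth real-valued functions on $[a,b]$. $M$ is a positive integer, $h=(b-a)/M$, $x_i=a+ih$, $\mu=\pi/(b-a)$, and $\boldsymbol\eta_k=(\eta_k(x_1),\dots,\eta_k(x_{M-1}))^\top$ for $k=1,2$. $\tilde{\mathbf A}$ is the $(M-1)\times(M-1)$ sine pseudo-spectral second-order differentiation matrix with entries, for $1\le i,j\le M-1$, $$\tilde{\mathbf A}_{i,j}=\begin{cases}(-1)^{i+j+1}\frac{\mu^2}2\big[\csc^2(\tfrac\mu2(i-j)h)-\csc^2(\tfrac\mu2(i+j)h)\big],& i\ne j,\\ -\frac{\mu^2}6-\frac{M^2\mu^2}3+\frac{\mu^2}2\csc^2(i\mu h),& i=j.\end{cases}$$ For $T>0$ and time step $\Delta t$, $t_n=n\Delta t$, $N=[T/\Delta t]$, and $\Delta B_k^n=B_k(t_n)-B_k(t_{n-1})$ for $k=0,1,2$. For vectors in $\mathbb{R}^{M-1}$, $\cdot$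 denotes the componentwise product, $\langle f,g\rangle_h=h\sum_{i=1}^{M-1}\operatorname{Re}(f_i\bar g_i)$ and $\|f\|_h=\sqrt{\langle f,f\rangle_h}$. The initial vectors $\mathbf P_M^0,\mathbf Q_M^0,\mathbf U_M^0,\mathbf V_M^0\in\mathbb{R}^{M-1}$ are the approximations at the grid points $x_1,\dots,x_{M-1}$ of $\operatorname{Re}\varphi_0,\operatorname{Im}\varphi_0,u_0,\tfrac12\mu_0$, where $\varphi_0,u_0,\mu_0$ are the initial data ($\varphi(0)=\varphi_0$, $u(0)=u_0$, $u_t(0)=\mu_0$) of the stochastic Klein--Gordon--Schrödinger equation with homogeneous Dirichlet boundary conditions that the scheme approximates. *)

theory Defs
  imports "HOL-Probability.Probability"
begin

definition std_wiener :: "'w measure \<Rightarrow> (real \<Rightarrow> 'w \<Rightarrow> real) \<Rightarrow> bool" where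
  "std_wiener Pr W \<longleftrightarrow>
     (\<forall>t\<ge>0. W t \<in> borel_measurable Pr) \<and>
     (AE \<omega> in Pr. W 0 \<omega> = 0) \<and>
     (\<forall>n (t :: nat \<Rightarrow> real). 0 \<le> t 0 \<longrightarrow> (\<forall>i<n. t i < t (Suc i)) \<longrightarrow>
        prob_space.indep_vars Pr (\<lambda>_. borel) (\<lambda>i \<omega>. W (t (Suc i)) \<omega> - W (t i) \<omega>) {..<n}) \<and>
     (\<forall>s t. 0 \<le> s \<longrightarrow> s < t \<longrightarrow>
        distributed Pr lborel (\<lambda>\<omega>. W t \<omega> - W s \<omega>) (normal_density 0 (sqrt (t - s)))) \<and>
     (AE \<omega> in Pr. continuous_on {0..} (\<lambda>t. W t \<omega>))"

text \<open>
  A vector of dimension \<open>M - 1\<close> is a function \<open>nat \<Rightarrow> real\<close> of which only the entries at the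
  indices \<open>1, \<dots>, M - 1\<close> matter; a matrix is treated likewise. For \<open>M = 1\<close> there are no entries.
\<close>

definition mesh :: "real \<Rightarrow> real \<Rightarrow> nat \<Rightarrow> real" where
  "mesh a b M = (b - a) / real M"

definition grid_fun :: "real \<Rightarrow> real \<Rightarrow> nat \<Rightarrow> (real \<Rightarrow> real) \<Rightarrow> nat \<Rightarrow> real" where
  "grid_fun a b M f i = f (a + real i * mesh a b M)"

definition csc :: "real \<Rightarrow> real" where
  "csc x = 1 / sin x"

definition sps_matrix :: "real \<Rightarrow> real \<Rightarrow> nat \<Rightarrow> nat \<Rightarrow> nat \<Rightarrow> real" where
  "sps_matrix a b M i j =
     (let \<mu> = pi / (b - a); h = mesh a b M in
      if i \<noteq> j then
        (-1) ^ (i + j + 1) * (\<mu>\<^sup>2 / 2) *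
          ((csc (\<mu> / 2 * (real i - real j) * h))\<^sup>2 - (csc (\<mu> / 2 * (real i + real j) * h))\<^sup>2)
      else - \<mu>\<^sup>2 / 6 - (real M)\<^sup>2 * \<mu>\<^sup>2 / 3 + \<mu>\<^sup>2 / 2 * (csc (real i * \<mu> * h))\<^sup>2)"

definition sps_apply :: "real \<Rightarrow> real \<Rightarrow> nat \<Rightarrow> (nat \<Rightarrow> real) \<Rightarrow> nat \<Rightarrow> real" where
  "sps_apply a b M v i = (\<Sum>j = 1..M - 1. sps_matrix a b M i j * v j)"

definition inner_h :: "real \<Rightarrow> real \<Rightarrow> nat \<Rightarrow> (nat \<Rightarrow> real) \<Rightarrow> (nat \<Rightarrow> real) \<Rightarrow> real" where
  "inner_h a b M f g = mesh a b M * (\<Sum>i = 1..M - 1. f i * g i)"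

definition norm_h :: "real \<Rightarrow> real \<Rightarrow> nat \<Rightarrow> (nat \<Rightarrow> real) \<Rightarrow> real" where
  "norm_h a b M f = sqrt (inner_h a b M f f)"

definition cprod :: "(nat \<Rightarrow> real) \<Rightarrow> (nat \<Rightarrow> real) \<Rightarrow> nat \<Rightarrow> real" (infixl \<open>\<odot>\<close> 70) where
  "(f \<odot> g) i = f i * g i"

definition charge :: "real \<Rightarrow> real \<Rightarrow> nat \<Rightarrow> (nat \<Rightarrow> real) \<Rightarrow> (nat \<Rightarrow> real) \<Rightarrow> real" where
  "charge a b M P Q = (norm_h a b M P)\<^sup>2 + (norm_h a b M Q)\<^sup>2"

definition energy ::
  "real \<Rightarrow> real \<Rightarrow> nat \<Rightarrow> (nat \<Rightarrow> real) \<Rightarrow> (nat \<Rightarrow> real) \<Rightarrow> (nat \<Rightarrow> real) \<Rightarrow> (nat \<Rightarrow> real) \<Rightarrow> real" where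
  "energy a b M P Q U V =
     2 * inner_h a b M U (\<lambda>i. (P \<odot> P) i + (Q \<odot> Q) i)
     - (norm_h a b M U)\<^sup>2 - 4 * (norm_h a b M V)\<^sup>2
     + inner_h a b M U (sps_apply a b M U)
     + 2 * inner_h a b M P (sps_apply a b M P)
     + 2 * inner_h a b M Q (sps_apply a b M Q)"

text \<open>
  One step of the scheme for a fixed sample: \<open>p, q, u, v\<close> are the vectors at the old time level,
  \<open>P, Q, U, V\<close> those at the new one; \<open>e1, e2\<close> are the grid vectors of the noise profiles and
  \<open>d k\<close> is the increment of the \<open>k\<close>-th Wiener process.
\<close>

definition sps_step ::
  "real \<Rightarrow> real \<Rightarrow> nat \<Rightarrow> real \<Rightarrow> real \<Rightarrow> real \<Rightarrow> (nat \<Rightarrow> real) \<Rightarrow> (nat \<Rightarrow> real) \<Rightarrow> (nat \<Rightarrow> real) \<Rightarrow>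
   (nat \<Rightarrow> real) \<Rightarrow> (nat \<Rightarrow> real) \<Rightarrow> (nat \<Rightarrow> real) \<Rightarrow> (nat \<Rightarrow> real) \<Rightarrow>
   (nat \<Rightarrow> real) \<Rightarrow> (nat \<Rightarrow> real) \<Rightarrow> (nat \<Rightarrow> real) \<Rightarrow> (nat \<Rightarrow> real) \<Rightarrow> bool" where
  "sps_step a b M dt C1 C2 e1 e2 d p q u v P Q U V \<longleftrightarrow>
    (let A = sps_apply a b M in
     \<forall>i\<in>{1..M - 1}.
       P i = p i - dt * (A (\<lambda>j. (Q j + q j) / 2) i + 1 / 2 * U i * (Q i + q i))
             + C1 * e1 i * d 1 + 1 / 2 * dt * C1 * d 0 * (A e1 i + U i * e1 i) \<and>
       Q i = q i + dt * (A (\<lambda>j. (P j + p j) / 2) i + 1 / 2 * U i * (P i + p i))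
             - C1 * e1 i * d 0 + 1 / 2 * dt * C1 * d 1 * (A e1 i + U i * e1 i) \<and>
       V i = v i + 1 / 2 * dt * (A (\<lambda>j. (U j + u j) / 2) i - (U i + u i) / 2
                                 + p i * p i + q i * q i)
             + 1 / 2 * C2 * e2 i * d 2
             + dt * (C1 * p i * e1 i * d 1 - C1 * q i * e1 i * d 0 + dt * C1\<^sup>2 * (e1 i * e1 i)) \<and>
       U i = u i + dt * (V i + v i) + 1 / 2 * dt * C2 * e2 i * d 2)"

end

theory Submission
  imports Defs
begin

text \<open>
  Write \<open>\<phi>\<^sub>0\<close> and \<open>\<phi>\<close> for \<open>P + i Q\<close> before and after a step, and
  \<open>\<psi> = \<phi>\<^sub>0 + C1 e1 (d1 - i d0)\<close>. The first two lines of the scheme say that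
  \<open>\<phi>\<close> is the Cayley transform of \<open>\<psi>\<close> by the symmetric operator \<open>A + U\<close>, so on every path the norm
  and the quadratic form of \<open>A + U\<close> agree at \<open>\<phi>\<close> and \<open>\<psi>\<close>; the charge law follows from
  \<open>E d1^2 = E d0^2 = dt\<close>. Multiplying the increments of \<open>V\<close> and \<open>U\<close> crosswise shows that the energy
  after the step is a quadratic polynomial in the noise with coefficients from the past, minus
  \<open>2 C1^2 \<langle>e1^2 \<zeta>, w\<rangle>\<close> with \<open>w\<close> the increment of \<open>U\<close> and \<open>\<zeta> = 2 dt - d1^2 - d0^2\<close>. The last term has
  mean zero because \<open>w\<close> solves a linear system with deterministic matrix whose right-hand side is
  affine in the noise. That matrix is coercive since \<open>A\<close> is negative semidefinite: in the sine basis
  it is diagonal with entries \<open>- (k \<mu>)^2\<close>.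
\<close>

section \<open>The sine pseudo-spectral matrix\<close>

text \<open>The obstacle is that the new \<open>U\<close> multiplies the new \<open>P\<close> and
  \<open>Q\<close> and depends on the same increments, so averages cannot be taken term by term. Two
  features of the scheme resolve this. The equations for \<open>U\<close> and \<open>V\<close>
  contain only the old \<open>P\<close> and \<open>Q\<close>, so \<open>U\<close> is determined
  before them. And the source in the equation for \<open>V\<close> is |\<psi>|^2 with
  \<open>d1^2 + d0^2\<close> replaced by its mean \<open>2 dt\<close>; this is the origin of the
  summand \<open>dt C1^2 e1^2\<close>. It keeps the wave equation affine in the noise and leaves
  \<zeta> as the only defect in the energy.

  The step is implicit, and neither measurability nor moments of its results are given.
  Measurability comes from elimination in two coercive systems: one with a fixed matrix for the
  increment of \<open>U\<close>, one with the random matrix of \<open>1 + dt^2/4 (A + U)^2\<close>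
  for \<open>P\<close>. Since the energy contains \<open>U (P^2 + Q^2)\<close>, the class carried
  through time is \<open>P^2, Q^2, U, V\<close> in L^2; the conserved norm and the coercivity of the
  wave system preserve it.\<close>

lemma sum_cos_multiples:
  fixes \<theta> :: real
  shows "2 * (1 - cos \<theta>) * (\<Sum>k<n. cos (real k * \<theta>)) =
    cos (real n * \<theta>) * cos \<theta> + sin (real n * \<theta>) * sin \<theta> - cos (real n * \<theta>) + 1 - cos \<theta>"
proof (induction n)
  \<comment> \<open>The factor \<open>2 * (1 - cos \<theta>)\<close> turns each summand into minus
    the second difference of the cosines, so the sum telescopes. The end term
    \<open>cos ((n - 1) * \<theta>)\<close> stands expanded, which keeps the formula valid at
    \<open>n = 0\<close>.\<close>
  case (Suc n)
  let ?c = "cos (real n * \<theta>)" and ?s = "sin (real n * \<theta>)"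
  have e: "real (Suc n) * \<theta> = real n * \<theta> + \<theta>" by (simp add: algebra_simps)
  have s2: "sin \<theta> * sin \<theta> = 1 - cos \<theta> * cos \<theta>"
    using sin_cos_squared_add[of \<theta>] by (simp add: power2_eq_square)
  have "(?c * cos \<theta> - ?s * sin \<theta>) * cos \<theta> + (?s * cos \<theta> + ?c * sin \<theta>) * sin \<theta>
      = ?c * (cos \<theta> * cos \<theta>) + ?c * (sin \<theta> * sin \<theta>)"
    by (simp add: algebra_simps)
  also have "\<dots> = ?c" unfolding s2 by (simp add: algebra_simps)
  finally show ?case
    using Suc unfolding e cos_add sin_add by (simp add: algebra_simps)
qed simp

text \<open>Summation by parts moves the second difference of the cosines onto the weight
  \<open>k^2\<close>, where it is the constant 2; hence the plain cosine sum on the right. The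
  summand 1 balances the boundary terms at \<open>n = 0\<close>.\<close>

lemma sum_square_cos_multiples:
  fixes \<theta> :: real
  shows "2 * (1 - cos \<theta>) * (\<Sum>k<n. (real k)\<^sup>2 * cos (real k * \<theta>)) =
    1 - 2 * (\<Sum>k<n. cos (real k * \<theta>)) - (real n - 1)\<^sup>2 * cos (real n * \<theta>)
    + (real n)\<^sup>2 * (cos (real n * \<theta>) * cos \<theta> + sin (real n * \<theta>) * sin \<theta>)"
proof (induction n)
  case (Suc n)
  let ?c = "cos (real n * \<theta>)" and ?s = "sin (real n * \<theta>)"
  have e: "real (Suc n) * \<theta> = real n * \<theta> + \<theta>" by (simp add: algebra_simps)
  have s2: "sin \<theta> * sin \<theta> = 1 - cos \<theta> * cos \<theta>"
    using sin_cos_squared_add[of \<theta>] by (simp add: power2_eq_square)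
  have rot: "(?c * cos \<theta> - ?s * sin \<theta>) * cos \<theta> + (?s * cos \<theta> + ?c * sin \<theta>) * sin \<theta> = ?c"
  proof -
    have "(?c * cos \<theta> - ?s * sin \<theta>) * cos \<theta> + (?s * cos \<theta> + ?c * sin \<theta>) * sin \<theta>
        = ?c * (cos \<theta> * cos \<theta>) + ?c * (sin \<theta> * sin \<theta>)"
      by (simp add: algebra_simps)
    also have "\<dots> = ?c" unfolding s2 by (simp add: algebra_simps)
    finally show ?thesis .
  qed
  show ?case
    using Suc unfolding e cos_add sin_add rot
    by (simp add: algebra_simps power2_eq_square)
qed simp

text \<open>At a zero of \<open>sin (n * \<theta>)\<close> the plain cosine sum is
  \<open>(1 - cos (n * \<theta>)) / 2\<close>, so every remaining term is a multiple of
  \<open>cos (n * \<theta>)\<close>. The cosecant comes from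
  \<open>1 - cos \<theta> = 2 * (sin (\<theta> / 2))^2\<close>.\<close>

lemma sum_square_cos_at_nodes:
  fixes \<theta> :: real
  assumes "sin (real n * \<theta>) = 0" and "sin (\<theta> / 2) \<noteq> 0"
  shows "(\<Sum>k<n. (real k)\<^sup>2 * cos (real k * \<theta>)) =
    cos (real n * \<theta>) * (real n / 2 * (csc (\<theta> / 2))\<^sup>2 - (real n)\<^sup>2 / 2)"
proof -
  define r where "r = (sin (\<theta> / 2))\<^sup>2"
  have r: "1 - cos \<theta> = 2 * r" "r \<noteq> 0"
    using cos_double_sin[of "\<theta> / 2"] assms(2) by (auto simp: r_def)
  have ct: "cos \<theta> = 1 - 2 * r" using r by simp
  define c where "c = cos (real n * \<theta>)"
  define S where "S = (\<Sum>k<n. cos (real k * \<theta>))"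
  define S2 where "S2 = (\<Sum>k<n. (real k)\<^sup>2 * cos (real k * \<theta>))"
  have "4 * r * S = 2 * r * (1 - c)"
    using sum_cos_multiples[of \<theta> n] assms(1)
    unfolding ct c_def[symmetric] S_def[symmetric] by (simp add: algebra_simps)
  hence S: "2 * S = 1 - c" using r(2) by simp
  have "4 * r * S2 = 1 - 2 * S - (real n - 1)\<^sup>2 * c + (real n)\<^sup>2 * (c * (1 - 2 * r))"
    using sum_square_cos_multiples[of \<theta> n] assms(1)
    unfolding ct c_def[symmetric] S_def[symmetric] S2_def[symmetric] by simp
  hence "4 * r * S2 = c * (2 * real n - 2 * r * (real n)\<^sup>2)"
    unfolding S by (simp add: algebra_simps power2_eq_square)
  hence "S2 = c * (2 * real n - 2 * r * (real n)\<^sup>2) / (4 * r)"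
    using r(2) by (simp add: field_simps)
  also have "\<dots> = c * (real n / 2 * (1 / r) - (real n)\<^sup>2 / 2)"
    using r(2) by (simp add: field_simps)
  finally show ?thesis
    by (simp add: S2_def c_def csc_def r_def power_divide)
qed

lemma sum_square_lessThan: "(\<Sum>k<n. (real k)\<^sup>2) = real n * (real n - 1) * (2 * real n - 1) / 6"
  by (induction n) (auto simp: field_simps power2_eq_square)

lemma sps_matrix_sym: "sps_matrix a b M i j = sps_matrix a b M j i"
proof -
  have "csc (x * (real i - real j) * h) ^ 2 = csc (x * (real j - real i) * h) ^ 2" for x h
  proof -
    have "x * (real i - real j) * h = - (x * (real j - real i) * h)" by (simp add: algebra_simps)
    thus ?thesis by (simp add: csc_def power2_eq_square)
  qed
  from this[of "pi / (b - a) / 2" "mesh a b M"] show ?thesis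
    unfolding sps_matrix_def Let_def by (simp only: add.commute[of i j] add.commute[of "real i" "real j"] eq_commute[of i j])
       (auto)
qed

text \<open>The half angles met below belong to \<open>i + j\<close> and to the distance of two
  different indices. Both numbers lie strictly between 0 and \<open>2 * M\<close>, so the cosecants
  are genuine reciprocals.\<close>

lemma sin_pos_node:
  assumes "0 < m" "m < 2 * M"
  shows "sin (real m * pi / real M / 2) > 0"
  using assms by (intro sin_gt_zero) (auto simp: field_simps)

text \<open>The matrix is the discrete sine transform, multiplication of mode \<open>k\<close> by
  \<open>- (k * \<mu>)^2\<close>, and the inverse transform; \<open>2 / M\<close> is the
  normalisation of that transform. A product of sines is half a difference of cosines at the angles
  \<open>D\<close> and \<open>E\<close>, which gives the two cosecants.\<close>

lemma sps_matrix_spectral: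
  assumes ab: "a < b" and i: "i \<in> {1..M - 1}" and j: "j \<in> {1..M - 1}"
  shows "sps_matrix a b M i j =
    - 2 / real M * (pi / (b - a))\<^sup>2 *
      (\<Sum>k<M. (real k)\<^sup>2 * sin (real k * (real i * pi / real M)) * sin (real k * (real j * pi / real M)))"
proof -
  have M: "M > 1" "i < M" "j < M" "i > 0" "j > 0" using i j by auto
  define \<mu> where "\<mu> = pi / (b - a)"
  define D where "D = (real i - real j) * pi / real M"
  define E where "E = real (i + j) * pi / real M"
  have \<mu>h: "\<mu> * mesh a b M = pi / real M"
    using ab by (simp add: \<mu>_def mesh_def)
  have arg: "\<mu> / 2 * (real i - real j) * mesh a b M = D / 2"
            "\<mu> / 2 * (real i + real j) * mesh a b M = E / 2"
            "real i * \<mu> * mesh a b M = real i * pi / real M"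
  proof -
    have *: "\<mu> / 2 * x * mesh a b M = x * pi / real M / 2" for x
      using \<mu>h by (metis (no_types, opaque_lifting) mult.commute mult.left_commute times_divide_eq_left times_divide_eq_right)
    show "\<mu> / 2 * (real i - real j) * mesh a b M = D / 2"
      "\<mu> / 2 * (real i + real j) * mesh a b M = E / 2"
      unfolding * D_def E_def by simp_all
    show "real i * \<mu> * mesh a b M = real i * pi / real M"
      using \<mu>h by (simp add: mult.assoc)
  qed
  have prod: "sin (real k * (real i * pi / real M)) * sin (real k * (real j * pi / real M))
      = (cos (real k * D) - cos (real k * E)) / 2" for k
  proof -
    have "real k * D = real k * (real i * pi / real M) - real k * (real j * pi / real M)"
      "real k * E = real k * (real i * pi / real M) + real k * (real j * pi / real M)"
      using M by (simp_all add: D_def E_def field_simps)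
    thus ?thesis by (simp add: sin_times_sin)
  qed
  have Msum: "2 * (\<Sum>k<M. (real k)\<^sup>2 * sin (real k * (real i * pi / real M)) * sin (real k * (real j * pi / real M)))
      = (\<Sum>k<M. (real k)\<^sup>2 * cos (real k * D)) - (\<Sum>k<M. (real k)\<^sup>2 * cos (real k * E))"
    unfolding mult.assoc prod sum_distrib_left sum_subtractf[symmetric]
    by (intro sum.cong refl) (simp add: field_simps)
  have ME: "real M * E = real (i + j) * pi" using M by (simp add: E_def)
  have cE: "cos (real M * E) = (-1) ^ (i + j)" "sin (real M * E) = 0"
    unfolding ME by (rule cos_npi, rule sin_npi)
  have sE: "sin (E / 2) \<noteq> 0"
    using sin_pos_node[of "i + j" M] M by (simp add: E_def)
  note SE = sum_square_cos_at_nodes[OF cE(2) sE, unfolded cE]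
  show ?thesis
  proof (cases "i = j")
    case False
    have MD: "real M * D = (real i - real j) * pi" using M by (simp add: D_def)
    \<comment> \<open>The parities of \<open>i - j\<close> and \<open>i + j\<close> agree, so both
      cosecants carry the same sign.\<close>
    have cD: "cos (real M * D) = (-1) ^ (i + j)" "sin (real M * D) = 0"
    proof -
      have "cos (real M * D) = cos (real i * pi) * cos (real j * pi) + sin (real i * pi) * sin (real j * pi)"
        unfolding MD by (simp add: left_diff_distrib cos_diff)
      thus "cos (real M * D) = (-1) ^ (i + j)" by (simp add: power_add)
      have "sin (real M * D) = sin (real i * pi) * cos (real j * pi) - cos (real i * pi) * sin (real j * pi)"
        unfolding MD by (simp add: left_diff_distrib sin_diff)
      thus "sin (real M * D) = 0" by simp
    qed
    have sD: "sin (D / 2) \<noteq> 0"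
    proof (cases "i < j")
      case True
      hence "sin (real (j - i) * pi / real M / 2) > 0" using M by (intro sin_pos_node) auto
      moreover have "D / 2 = - (real (j - i) * pi / real M / 2)"
        using True M by (simp add: D_def of_nat_diff field_simps)
      ultimately show ?thesis by (metis sin_minus neg_equal_0_iff_equal less_irrefl)
    next
      case F: False
      hence "sin (real (i - j) * pi / real M / 2) > 0" using M False by (intro sin_pos_node) auto
      moreover have "D / 2 = real (i - j) * pi / real M / 2"
        using F M by (simp add: D_def of_nat_diff field_simps)
      ultimately show ?thesis by (metis less_irrefl)
    qed
    note SD = sum_square_cos_at_nodes[OF cD(2) sD, unfolded cD]
    have Z: "(\<Sum>k<M. (real k)\<^sup>2 * sin (real k * (real i * pi / real M)) * sin (real k * (real j * pi / real M)))
      = 1 / 2 * ((-1) ^ (i + j) * (real M / 2 * ((csc (D / 2))\<^sup>2 - (csc (E / 2))\<^sup>2)))"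
      using Msum unfolding SD SE by (simp add: algebra_simps)
    have sm: "sps_matrix a b M i j = (-1) ^ (i + j + 1) * (\<mu>\<^sup>2 / 2) * ((csc (D / 2))\<^sup>2 - (csc (E / 2))\<^sup>2)"
      unfolding sps_matrix_def Let_def \<mu>_def[symmetric] arg using False by simp
    show ?thesis unfolding sm Z \<mu>_def[symmetric] using M by (simp add: field_simps)
  next
    case True
    hence D0: "D = 0" by (simp add: D_def)
    have E2: "E / 2 = real i * pi / real M" using True by (simp add: E_def field_simps)
    \<comment> \<open>On the diagonal the cosine sum at \<open>D = 0\<close> is the plain sum of
      squares. Together with \<open>M^2 / 2\<close> from the sum at \<open>E\<close> it yields the
      constants \<open>\<mu>^2 / 6\<close> and \<open>M^2 * \<mu>^2 / 3\<close>; the terms of first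
      order in \<open>M\<close> cancel.\<close>
    have Z: "(\<Sum>k<M. (real k)\<^sup>2 * sin (real k * (real i * pi / real M)) * sin (real k * (real j * pi / real M)))
      = 1 / 2 * (real M * (real M - 1) * (2 * real M - 1) / 6 -
       (real M / 2 * (csc (real i * pi / real M))\<^sup>2 - (real M)\<^sup>2 / 2))"
      using Msum unfolding SE by (simp add: D0 sum_square_lessThan E2 True)
    have sm: "sps_matrix a b M i j = - \<mu>\<^sup>2 / 6 - (real M)\<^sup>2 * \<mu>\<^sup>2 / 3 + \<mu>\<^sup>2 / 2 * (csc (real i * pi / real M))\<^sup>2"
      unfolding sps_matrix_def Let_def \<mu>_def[symmetric] arg using True by simp
    show ?thesis
      unfolding sm Z \<mu>_def[symmetric] using M by (simp add: field_simps power2_eq_square)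
  qed
qed

text \<open>In the spectral form the double sum over \<open>i\<close> and \<open>j\<close> becomes,
  for each mode \<open>k\<close>, a square with a nonpositive weight.\<close>

lemma sps_apply_nonpos:
  assumes ab: "a < b"
  shows "(\<Sum>i = 1..M - 1. y i * sps_apply a b M y i) \<le> 0"
proof -
  let ?I = "{1..M - 1}"
  let ?s = "\<lambda>k i. sin (real k * (real i * pi / real M))"
  let ?c = "- 2 / real M * (pi / (b - a))\<^sup>2"
  have "(\<Sum>i\<in>?I. y i * sps_apply a b M y i) =
      (\<Sum>i\<in>?I. \<Sum>j\<in>?I. \<Sum>k<M. ?c * ((real k)\<^sup>2 * ((y i * ?s k i) * (y j * ?s k j))))"
    unfolding sps_apply_def sum_distrib_left
    by (intro sum.cong refl) (simp add: sps_matrix_spectral[OF ab] sum_distrib_left sum_distrib_right mult_ac)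
  also have "\<dots> = (\<Sum>k<M. ?c * ((real k)\<^sup>2 * (\<Sum>i\<in>?I. y i * ?s k i)\<^sup>2))"
    unfolding power2_eq_square[of "sum _ _"] sum_product unfolding sum_distrib_left
      sum.swap[where B = "{..<M}"] by (rule refl)
  also have "\<dots> \<le> 0"
    by (intro sum_nonpos mult_nonpos_nonneg) auto
  finally show ?thesis .
qed

lemma sps_apply_self_adjoint:
  "(\<Sum>i = 1..M - 1. x i * sps_apply a b M y i) = (\<Sum>i = 1..M - 1. y i * sps_apply a b M x i)"
  unfolding sps_apply_def sum_distrib_left
  by (subst sum.swap) (simp add: sps_matrix_sym[of a b M] mult_ac)

section \<open>Coercive linear systems\<close>

text \<open>Elimination of one unknown at a time writes the solution as a rational function of the
  coefficients and the right-hand side, and coercivity keeps the pivots nonzero. The matrix may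
  depend on the sample because the system for \<open>P\<close> contains \<open>U\<close>. The
  solution \<open>x\<close> stays fixed in the induction, while \<open>K\<close> and
  \<open>c\<close> pass to their reduced versions.\<close>

lemma coercive_system_measurable:
  fixes K :: "'i \<Rightarrow> 'i \<Rightarrow> 'w \<Rightarrow> real"
  assumes "finite I"
    and "\<And>i j. i \<in> I \<Longrightarrow> j \<in> I \<Longrightarrow> K i j \<in> borel_measurable F"
    and "\<And>i. i \<in> I \<Longrightarrow> c i \<in> borel_measurable F"
    and "\<And>\<omega> y. \<omega> \<in> space F \<Longrightarrow>
      (\<Sum>i\<in>I. (y i)\<^sup>2) \<le> (\<Sum>i\<in>I. y i * (\<Sum>j\<in>I. K i j \<omega> * y j))"
    and "\<And>\<omega> i. \<omega> \<in> space F \<Longrightarrow> i \<in> I \<Longrightarrow> (\<Sum>j\<in>I. K i j \<omega> * x j \<omega>) = c i \<omega>"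
  shows "\<forall>i\<in>I. x i \<in> borel_measurable F"
  using assms
proof (induction I arbitrary: K c rule: finite_induct)
  case (insert k I)
  note Kmeas = insert.prems(1) and cmeas = insert.prems(2)
    and coer = insert.prems(3) and sol = insert.prems(4)
  have k_notin: "i \<noteq> k" if "i \<in> I" for i using that insert.hyps by auto
  \<comment> \<open>Tested with the \<open>k\<close>-th unit vector, coercivity says
    \<open>1 \<le> K k k \<omega>\<close>.\<close>
  have Kkk: "K k k \<omega> \<noteq> 0" if "\<omega> \<in> space F" for \<omega>
  proof -
    have "(\<Sum>i\<in>I. (if i = k then 1 else 0::real)\<^sup>2) = 0"
      "(\<Sum>i\<in>I. (if i = k then 1 else 0::real) * (\<Sum>j\<in>insert k I. K i j \<omega> * (if j = k then 1 else 0))) = 0"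
      using insert.hyps by (auto intro!: sum.neutral)
    moreover have "(\<Sum>j\<in>I. K k j \<omega> * (if j = k then 1 else 0)) = 0"
      using insert.hyps by (auto intro!: sum.neutral)
    ultimately show ?thesis
      using coer[OF that, of "\<lambda>i. if i = k then 1 else 0"] insert.hyps
      by (auto simp: sum.insert)
  qed
  define K' where "K' i j \<omega> = K i j \<omega> - K i k \<omega> * K k j \<omega> / K k k \<omega>" for i j \<omega>
  define c' where "c' i \<omega> = c i \<omega> - K i k \<omega> * c k \<omega> / K k k \<omega>" for i \<omega>
  \<comment> \<open>The Schur complement of the entry \<open>(k, k)\<close> inherits coercivity: a vector on \<open>I\<close> extends to
      one on \<open>insert k I\<close> that the \<open>k\<close>-th row annihilates.\<close>
  have elim: "(\<Sum>j\<in>I. K' i j \<omega> * y j) = (\<Sum>j\<in>I. K i j \<omega> * y j) - K i k \<omega> / K k k \<omega> * (\<Sum>j\<in>I. K k j \<omega> * y j)"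
    for i \<omega> y
    unfolding K'_def sum_distrib_left sum_subtractf[symmetric]
    by (intro sum.cong refl) (simp add: algebra_simps)
  have IH: "\<forall>i\<in>I. x i \<in> borel_measurable F"
  proof (rule insert.IH[of K' c'])
    show "K' i j \<in> borel_measurable F" if "i \<in> I" "j \<in> I" for i j
      unfolding K'_def using that
      by (intro borel_measurable_diff borel_measurable_divide borel_measurable_times Kmeas) auto
    show "c' i \<in> borel_measurable F" if "i \<in> I" for i
      unfolding c'_def using that
      by (intro borel_measurable_diff borel_measurable_divide borel_measurable_times Kmeas cmeas) auto
  next
    fix \<omega> y assume \<omega>: "\<omega> \<in> space F"
    define s where "s = (\<Sum>j\<in>I. K k j \<omega> * y j)"
    define z where "z i = (if i = k then - s / K k k \<omega> else y i)" for i
    have zI: "z i = y i" if "i \<in> I" for i using k_notin[OF that] by (simp add: z_def)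
    have zk: "z k = - s / K k k \<omega>" by (simp add: z_def)
    have zs: "(\<Sum>j\<in>I. K i j \<omega> * z j) = (\<Sum>j\<in>I. K i j \<omega> * y j)" for i
      by (intro sum.cong refl) (simp add: zI)
    have row_k: "(\<Sum>j\<in>insert k I. K k j \<omega> * z j) = 0"
      using insert.hyps Kkk[OF \<omega>] zs[of k] by (simp add: zk s_def)
    have row: "(\<Sum>j\<in>insert k I. K i j \<omega> * z j) = (\<Sum>j\<in>I. K' i j \<omega> * y j)" for i
      using insert.hyps zs[of i] by (simp add: zk elim s_def)
    have "(\<Sum>i\<in>I. (y i)\<^sup>2) = (\<Sum>i\<in>I. (z i)\<^sup>2)"
      by (intro sum.cong refl) (simp add: zI)
    also have "\<dots> \<le> (\<Sum>i\<in>insert k I. (z i)\<^sup>2)"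
      using insert.hyps by simp
    also have "\<dots> \<le> (\<Sum>i\<in>insert k I. z i * (\<Sum>j\<in>insert k I. K i j \<omega> * z j))"
      by (rule coer[OF \<omega>])
    also have "\<dots> = (\<Sum>i\<in>I. z i * (\<Sum>j\<in>insert k I. K i j \<omega> * z j))"
      by (subst sum.insert) (use insert.hyps row_k in auto)
    also have "\<dots> = (\<Sum>i\<in>I. y i * (\<Sum>j\<in>I. K' i j \<omega> * y j))"
      by (intro sum.cong refl) (simp add: row zI)
    finally show "(\<Sum>i\<in>I. (y i)\<^sup>2) \<le> (\<Sum>i\<in>I. y i * (\<Sum>j\<in>I. K' i j \<omega> * y j))" .
  next
    fix \<omega> i assume \<omega>: "\<omega> \<in> space F" and i: "i \<in> I"
    have eqs: "K i k \<omega> * x k \<omega> + (\<Sum>j\<in>I. K i j \<omega> * x j \<omega>) = c i \<omega>"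
      "K k k \<omega> * x k \<omega> + (\<Sum>j\<in>I. K k j \<omega> * x j \<omega>) = c k \<omega>"
      using sol[OF \<omega>, of i] sol[OF \<omega>, of k] insert.hyps i by auto
    thus "(\<Sum>j\<in>I. K' i j \<omega> * x j \<omega>) = c' i \<omega>"
      unfolding elim c'_def eqs[symmetric] using Kkk[OF \<omega>] by (simp add: field_simps)
  qed
  have "(\<lambda>\<omega>. (c k \<omega> - (\<Sum>j\<in>I. K k j \<omega> * x j \<omega>)) / K k k \<omega>) \<in> borel_measurable F"
    using IH Kmeas cmeas
    by (intro borel_measurable_divide borel_measurable_diff borel_measurable_sum borel_measurable_times) auto
  moreover have "x k \<omega> = (c k \<omega> - (\<Sum>j\<in>I. K k j \<omega> * x j \<omega>)) / K k k \<omega>" if "\<omega> \<in> space F" for \<omega>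
    using sol[OF that, of k] Kkk[OF that] insert.hyps by (simp add: field_simps)
  ultimately have "x k \<in> borel_measurable F"
    by (subst measurable_cong) auto
  with IH show ?case by auto
qed simp

section \<open>Pathwise identities\<close>

lemma sps_apply_cong:
  "(\<And>j. j \<in> {1..M - 1} \<Longrightarrow> x j = y j) \<Longrightarrow> sps_apply a b M x i = sps_apply a b M y i"
  unfolding sps_apply_def by (intro sum.cong) auto

lemma sps_apply_add: "sps_apply a b M (\<lambda>j. x j + y j) i = sps_apply a b M x i + sps_apply a b M y i"
  by (simp add: sps_apply_def distrib_left sum.distrib)

lemma sps_apply_diff: "sps_apply a b M (\<lambda>j. x j - y j) i = sps_apply a b M x i - sps_apply a b M y i"
  by (simp add: sps_apply_def right_diff_distrib sum_subtractf)

lemma sps_apply_scale: "sps_apply a b M (\<lambda>j. c * x j) i = c * sps_apply a b M x i"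
  by (simp add: sps_apply_def sum_distrib_left mult_ac)

lemma sps_apply_half: "sps_apply a b M (\<lambda>j. x j / 2) i = sps_apply a b M x i / 2"
  using sps_apply_scale[of a b M "1/2" x i] by simp

text \<open>The discrete Schroedinger operator. Its potential is a parameter because the
  conservation laws hold with the new \<open>U\<close>, while the energy after the step is expanded
  around the old \<open>u\<close>.\<close>

definition sps_potential :: "real \<Rightarrow> real \<Rightarrow> nat \<Rightarrow> (nat \<Rightarrow> real) \<Rightarrow> (nat \<Rightarrow> real) \<Rightarrow> nat \<Rightarrow> real" where
  "sps_potential a b M U x i = sps_apply a b M x i + U i * x i"

lemma sps_potential_cong:
  "(\<And>j. j \<in> {1..M - 1} \<Longrightarrow> x j = y j) \<Longrightarrow> i \<in> {1..M - 1} \<Longrightarrow>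
    sps_potential a b M U x i = sps_potential a b M U y i"
  unfolding sps_potential_def by (metis sps_apply_cong)

lemma sps_potential_add:
  "sps_potential a b M U (\<lambda>j. x j + y j) i = sps_potential a b M U x i + sps_potential a b M U y i"
  by (simp add: sps_potential_def sps_apply_add algebra_simps)

lemma sps_potential_scale:
  "sps_potential a b M U (\<lambda>j. c * x j) i = c * sps_potential a b M U x i"
  by (simp add: sps_potential_def sps_apply_scale algebra_simps)

lemma sps_potential_self_adjoint:
  "(\<Sum>i = 1..M - 1. x i * sps_potential a b M U y i) = (\<Sum>i = 1..M - 1. y i * sps_potential a b M U x i)"
  using sps_apply_self_adjoint[of x a b M y]
  by (simp add: sps_potential_def distrib_left sum.distrib mult_ac)

text \<open>The cross terms cancel by symmetry. The operator is abstract since this serves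
  \<open>A + U\<close> in the Schroedinger part and \<open>A - 1\<close> in the wave part.\<close>

lemma self_adjoint_difference:
  assumes "\<And>x y :: nat \<Rightarrow> real. (\<Sum>i\<in>I. x i * L y i) = (\<Sum>i\<in>I. y i * L x i :: real)"
    and "\<And>x y i. L (\<lambda>j. x j + y j) i = L x i + L y i"
  shows "(\<Sum>i\<in>I. (x i - y i) * L (\<lambda>j. x j + y j) i) = (\<Sum>i\<in>I. x i * L x i) - (\<Sum>i\<in>I. y i * L y i)"
  using assms(1)[of x y]
  by (simp add: assms(2) algebra_simps sum.distrib sum_subtractf)

text \<open>As \<open>A\<close> is negative semidefinite, \<open>- t * (A - 1)\<close> only enlarges
  the quadratic form of the identity. The scheme leads to \<open>t = dt^2 / 4\<close>.\<close>

lemma wave_operator_coercive: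
  assumes "a < b" "t \<ge> 0"
  shows "(\<Sum>i = 1..M - 1. (x i)\<^sup>2) \<le> (\<Sum>i = 1..M - 1. x i * (x i - t * (sps_apply a b M x i - x i)))"
proof -
  have "(\<Sum>i = 1..M - 1. x i * (x i - t * (sps_apply a b M x i - x i))) =
     (\<Sum>i = 1..M - 1. (x i)\<^sup>2) + t * ((\<Sum>i = 1..M - 1. (x i)\<^sup>2) - (\<Sum>i = 1..M - 1. x i * sps_apply a b M x i))"
    unfolding sum_subtractf[symmetric] sum_distrib_left sum.distrib[symmetric]
    by (intro sum.cong refl) (simp add: algebra_simps power2_eq_square)
  moreover have "0 \<le> t * ((\<Sum>i = 1..M - 1. (x i)\<^sup>2) - (\<Sum>i = 1..M - 1. x i * sps_apply a b M x i))"
    using sps_apply_nonpos[OF assms(1), of x M] assms(2) sum_nonneg[of "{1..M - 1}" "\<lambda>i. (x i)\<^sup>2"]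
    by (intro mult_nonneg_nonneg) auto
  ultimately show ?thesis by simp
qed

text \<open>By \<open>2 * x * c \<le> x^2 + c^2\<close>; coercivity with constant 1 thus bounds the
  solution by the right-hand side with constant 1.\<close>

lemma coercive_imp_bounded:
  fixes x c :: "'i \<Rightarrow> real"
  assumes "(\<Sum>i\<in>I. (x i)\<^sup>2) \<le> (\<Sum>i\<in>I. x i * c i)"
  shows "(\<Sum>i\<in>I. (x i)\<^sup>2) \<le> (\<Sum>i\<in>I. (c i)\<^sup>2)"
proof -
  have "2 * (\<Sum>i\<in>I. x i * c i) \<le> (\<Sum>i\<in>I. (x i)\<^sup>2) + (\<Sum>i\<in>I. (c i)\<^sup>2)"
    unfolding sum_distrib_left sum.distrib[symmetric]
    using sum_squares_bound by (intro sum_mono) (simp add: mult.assoc)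
  with assms show ?thesis by linarith
qed

lemma norm_h_square:
  assumes "a < b"
  shows "(norm_h a b M x)\<^sup>2 = mesh a b M * (\<Sum>i = 1..M - 1. (x i)\<^sup>2)"
proof -
  have "0 \<le> (\<Sum>i = 1..M - 1. x i * x i)" by (intro sum_nonneg) simp
  with assms show ?thesis by (simp add: norm_h_def inner_h_def mesh_def power2_eq_square)
qed

text \<open>The cubic term joins the quadratic forms of \<open>A\<close> at \<open>P\<close> and
  \<open>Q\<close> to give twice the form of \<open>A + U\<close>; the terms in \<open>U\<close>
  alone are the form of \<open>A - 1\<close>.\<close>

lemma energy_eq_sum:
  assumes "a < b"
  shows "energy a b M P Q U V = mesh a b M * (\<Sum>i = 1..M - 1.
     2 * (P i * sps_potential a b M U P i + Q i * sps_potential a b M U Q i)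
     + U i * (sps_apply a b M U i - U i) - 4 * (V i)\<^sup>2)"
  unfolding energy_def inner_h_def norm_h_square[OF assms] cprod_def
  unfolding sum_distrib_left sum_subtractf[symmetric] sum.distrib[symmetric]
  by (intro sum.cong refl) (simp add: algebra_simps power2_eq_square sps_potential_def)

locale sps_update =
  fixes a b dt C1 C2 :: real and M :: nat and e1 e2 d p q u v P Q U V :: "nat \<Rightarrow> real"
  assumes step: "sps_step a b M dt C1 C2 e1 e2 d p q u v P Q U V"
    and ab: "a < b" and dt_pos: "dt > 0"
begin

abbreviation (input) "A \<equiv> sps_apply a b M"
abbreviation (input) "L \<equiv> sps_potential a b M U"
text \<open>\<open>p1\<close> and \<open>q1\<close> are the parts of \<psi>, and \<open>v1\<close>
  is \<open>v\<close> with its own noise added. Starting from these shifted data, noise remains only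
  inside the source \<open>R\<close>.\<close>

abbreviation (input) "p1 \<equiv> \<lambda>i. p i + C1 * d 1 * e1 i"
abbreviation (input) "q1 \<equiv> \<lambda>i. q i - C1 * d 0 * e1 i"
abbreviation (input) "v1 \<equiv> \<lambda>i. v i + C2 / 2 * d 2 * e2 i"
text \<open>\<open>R\<close> is \<open>p1^2 + q1^2\<close> plus \<open>C1^2 * e1^2\<close> times
  \<open>2 * dt - d1^2 - d0^2\<close>, so all squares of increments have dropped out.\<close>

abbreviation (input) "R \<equiv> \<lambda>i. (p i)\<^sup>2 + (q i)\<^sup>2 + 2 * C1 * e1 i * (p i * d 1)
  - 2 * C1 * e1 i * (q i * d 0) + 2 * dt * C1\<^sup>2 * (e1 i)\<^sup>2"
abbreviation (input) "w \<equiv> \<lambda>i. U i - u i"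
abbreviation (input) "wave_rhs \<equiv> \<lambda>i. dt * (2 * v1 i + dt / 2 * (A u i - u i + R i))"

text \<open>The correction terms of the scheme with \<open>dt * C1 * d 0\<close> and
  \<open>dt * C1 * d 1\<close> are exactly those that replace the old \<open>q\<close> and
  \<open>p\<close> by \<open>q1\<close> and \<open>p1\<close> under the operator.\<close>

lemma cayley:
  assumes "i \<in> {1..M - 1}"
  shows "P i - p1 i = - dt / 2 * L (\<lambda>j. Q j + q1 j) i"
    and "Q i - q1 i = dt / 2 * L (\<lambda>j. P j + p1 j) i"
proof -
  have P: "P i = p i - dt * (A (\<lambda>j. (Q j + q j) / 2) i + 1 / 2 * U i * (Q i + q i))
             + C1 * e1 i * d 1 + 1 / 2 * dt * C1 * d 0 * (A e1 i + U i * e1 i)"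
    and Q: "Q i = q i + dt * (A (\<lambda>j. (P j + p j) / 2) i + 1 / 2 * U i * (P i + p i))
             - C1 * e1 i * d 0 + 1 / 2 * dt * C1 * d 1 * (A e1 i + U i * e1 i)"
    using step assms unfolding sps_step_def Let_def by blast+
  show "P i - p1 i = - dt / 2 * L (\<lambda>j. Q j + q1 j) i"
    using P unfolding sps_potential_def sps_apply_half sps_apply_add sps_apply_diff sps_apply_scale
    by (simp add: field_simps)
  show "Q i - q1 i = dt / 2 * L (\<lambda>j. P j + p1 j) i"
    using Q unfolding sps_potential_def sps_apply_half sps_apply_add sps_apply_diff sps_apply_scale
    by (simp add: field_simps)
qed

text \<open>The sum and the difference are singled out because their product is
  \<open>V^2 - v1^2\<close>, the kinetic part of the energy balance.\<close>

lemma velocity: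
  assumes "i \<in> {1..M - 1}"
  shows "V i + v1 i = w i / dt"
    and "V i - v1 i = dt / 2 * ((A (\<lambda>j. U j + u j) i - (U i + u i)) / 2 + R i)"
proof -
  have V: "V i = v i + 1 / 2 * dt * (A (\<lambda>j. (U j + u j) / 2) i - (U i + u i) / 2 + p i * p i + q i * q i)
             + 1 / 2 * C2 * e2 i * d 2
             + dt * (C1 * p i * e1 i * d 1 - C1 * q i * e1 i * d 0 + dt * C1\<^sup>2 * (e1 i * e1 i))"
    and U: "U i = u i + dt * (V i + v i) + 1 / 2 * dt * C2 * e2 i * d 2"
    using step assms unfolding sps_step_def Let_def by blast+
  show "V i + v1 i = w i / dt"
    using U dt_pos by (simp add: field_simps)
  show "V i - v1 i = dt / 2 * ((A (\<lambda>j. U j + u j) i - (U i + u i)) / 2 + R i)"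
    unfolding V sps_apply_half by (simp add: field_simps power2_eq_square)
qed

text \<open>\<open>V\<close> is eliminated by writing \<open>V + v1\<close> as
  \<open>2 * v1 + (V - v1)\<close>. The right-hand side contains old data and increments
  only.\<close>

lemma wave_system:
  assumes "i \<in> {1..M - 1}"
  shows "w i - dt\<^sup>2 / 4 * (A w i - w i) = wave_rhs i"
proof -
  have A: "A (\<lambda>j. U j + u j) i = A w i + 2 * A u i"
    by (simp add: sps_apply_add sps_apply_diff)
  have "w i = dt * (2 * v1 i + (V i - v1 i))"
    using velocity(1)[OF assms] dt_pos by (simp add: field_simps)
  also have "\<dots> = dt * (2 * v1 i + dt / 2 * ((A w i + 2 * A u i - (w i + 2 * u i)) / 2 + R i))"
    unfolding velocity(2)[OF assms] A by simp
  finally show ?thesis by (simp add: field_simps power2_eq_square)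
qed

lemma wave_bound: "i \<in> {1..M - 1} \<Longrightarrow> (w i)\<^sup>2 \<le> (\<Sum>j = 1..M - 1. (wave_rhs j)\<^sup>2)"
proof -
  assume i: "i \<in> {1..M - 1}"
  have "(\<Sum>i = 1..M - 1. (w i)\<^sup>2) \<le> (\<Sum>i = 1..M - 1. w i * (w i - dt\<^sup>2 / 4 * (A w i - w i)))"
    by (rule wave_operator_coercive[OF ab]) simp
  also have "\<dots> = (\<Sum>i = 1..M - 1. w i * wave_rhs i)"
    by (intro sum.cong refl) (simp only: wave_system)
  finally have "(\<Sum>i = 1..M - 1. (w i)\<^sup>2) \<le> (\<Sum>i = 1..M - 1. (wave_rhs i)\<^sup>2)"
    by (rule coercive_imp_bounded)
  moreover have "(w i)\<^sup>2 \<le> (\<Sum>i = 1..M - 1. (w i)\<^sup>2)"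
    using i by (intro member_le_sum) auto
  ultimately show ?thesis by linarith
qed

text \<open>Testing the two Cayley equations with \<open>P + p1\<close> and \<open>Q + q1\<close>
  leaves two mixed terms of opposite sign, which agree in size because \<open>A + U\<close> is
  symmetric. The resulting bound on \<open>P\<close> and \<open>Q\<close> is free of
  \<open>U\<close>.\<close>

lemma charge_conserved: "(\<Sum>i = 1..M - 1. (P i)\<^sup>2 + (Q i)\<^sup>2) = (\<Sum>i = 1..M - 1. (p1 i)\<^sup>2 + (q1 i)\<^sup>2)"
proof -
  let ?s = "\<lambda>j. P j + p1 j" and ?r = "\<lambda>j. Q j + q1 j"
  have factor: "s * (- dt / 2 * X) + r * (dt / 2 * Y) = - dt / 2 * (s * X) + dt / 2 * (r * Y)"
    for s r X Y :: real by (simp add: algebra_simps)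
  have "(\<Sum>i = 1..M - 1. (P i)\<^sup>2 + (Q i)\<^sup>2) - (\<Sum>i = 1..M - 1. (p1 i)\<^sup>2 + (q1 i)\<^sup>2)
      = (\<Sum>i = 1..M - 1. ?s i * (P i - p1 i) + ?r i * (Q i - q1 i))"
    unfolding sum_subtractf[symmetric]
    by (intro sum.cong refl) (simp add: algebra_simps power2_eq_square)
  also have "\<dots> = (\<Sum>i = 1..M - 1. - dt / 2 * (?s i * L ?r i) + dt / 2 * (?r i * L ?s i))"
    by (intro sum.cong refl) (simp only: cayley factor)
  also have "\<dots> = 0"
    using sps_potential_self_adjoint[of ?s a b M U ?r]
    unfolding sum.distrib sum_distrib_left[symmetric] by simp
  finally show ?thesis by simp
qed

text \<open>By polarisation the difference pairs the increments with \<open>L (P + p1)\<close> and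
  \<open>L (Q + q1)\<close>. The Cayley equations make the two products opposite at every
  node.\<close>

lemma potential_energy_conserved:
  "(\<Sum>i = 1..M - 1. P i * L P i + Q i * L Q i) = (\<Sum>i = 1..M - 1. p1 i * L p1 i + q1 i * L q1 i)"
proof -
  let ?s = "\<lambda>j. P j + p1 j" and ?r = "\<lambda>j. Q j + q1 j"
  have "(\<Sum>i = 1..M - 1. P i * L P i + Q i * L Q i) - (\<Sum>i = 1..M - 1. p1 i * L p1 i + q1 i * L q1 i)
      = (\<Sum>i = 1..M - 1. (P i - p1 i) * L ?s i) + (\<Sum>i = 1..M - 1. (Q i - q1 i) * L ?r i)"
    using self_adjoint_difference[where I = "{1..M - 1}" and L = L, OF sps_potential_self_adjoint sps_potential_add]
    by (simp add: sum.distrib)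
  also have "\<dots> = 0"
    unfolding sum.distrib[symmetric]
    by (intro sum.neutral ballI) (simp only: cayley, simp)
  finally show ?thesis by simp
qed

text \<open>In the product of the two velocity equations \<open>dt\<close> cancels. What is left is
  \<open>w\<close> paired with \<open>(A - 1) (U + u)\<close>, a difference of quadratic forms, and
  the work \<open>2 * R * w\<close> of the source.\<close>

lemma wave_energy:
  "(\<Sum>i = 1..M - 1. U i * (A U i - U i) - 4 * (V i)\<^sup>2) =
   (\<Sum>i = 1..M - 1. u i * (A u i - u i) - 4 * (v1 i)\<^sup>2 - 2 * R i * w i)"
proof -
  let ?L = "\<lambda>x i. A x i - x i"
  have "(\<Sum>i = 1..M - 1. w i * ?L (\<lambda>j. U j + u j) i) =
      (\<Sum>i = 1..M - 1. U i * ?L U i) - (\<Sum>i = 1..M - 1. u i * ?L u i)"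
  proof (rule self_adjoint_difference)
    show "(\<Sum>i = 1..M - 1. x i * ?L y i) = (\<Sum>i = 1..M - 1. y i * ?L x i)" for x y
      using sps_apply_self_adjoint[of x a b M y]
      by (simp add: right_diff_distrib sum_subtractf mult_ac)
  qed (simp add: sps_apply_add)
  moreover have "(\<Sum>i = 1..M - 1. 4 * (V i)\<^sup>2 - 4 * (v1 i)\<^sup>2) =
      (\<Sum>i = 1..M - 1. w i * ?L (\<lambda>j. U j + u j) i + 2 * R i * w i)"
  proof (intro sum.cong refl)
    fix i assume i: "i \<in> {1..M - 1}"
    have "4 * (V i)\<^sup>2 - 4 * (v1 i)\<^sup>2 = 4 * ((V i + v1 i) * (V i - v1 i))"
      by (simp add: algebra_simps power2_eq_square)
    also have "\<dots> = 4 * (w i / dt * (dt / 2 * (?L (\<lambda>j. U j + u j) i / 2 + R i)))"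
      by (simp only: velocity[OF i])
    also have "\<dots> = w i * ?L (\<lambda>j. U j + u j) i + 2 * R i * w i"
      using dt_pos by (simp add: field_simps)
    finally show "4 * (V i)\<^sup>2 - 4 * (v1 i)\<^sup>2 = w i * ?L (\<lambda>j. U j + u j) i + 2 * R i * w i" .
  qed
  ultimately show ?thesis by (simp add: sum.distrib sum_subtractf)
qed

text \<open>Inserting the second Cayley equation into the first removes \<open>Q\<close> and
  replaces the skew coupling by a real symmetric coercive system for \<open>P + p1\<close>;
  \<open>Q\<close> is then explicit. This form serves measurability.\<close>

lemma schroedinger_system:
  assumes i: "i \<in> {1..M - 1}"
  shows "(P i + p1 i) + dt\<^sup>2 / 4 * L (L (\<lambda>j. P j + p1 j)) i = 2 * p1 i - dt * L q1 i"
    and "Q i = q1 i + dt / 2 * L (\<lambda>j. P j + p1 j) i"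
proof -
  let ?s = "\<lambda>j. P j + p1 j" and ?r = "\<lambda>j. Q j + q1 j"
  show "Q i = q1 i + dt / 2 * L ?s i" using cayley(2)[OF i] by simp
  have "L ?r i = L (\<lambda>j. 2 * q1 j + dt / 2 * L ?s j) i"
  proof (rule sps_potential_cong[OF _ i])
    fix j assume "j \<in> {1..M - 1}"
    from cayley(2)[OF this] show "?r j = 2 * q1 j + dt / 2 * L ?s j" by simp
  qed
  also have "\<dots> = 2 * L q1 i + dt / 2 * L (L ?s) i"
    unfolding sps_potential_add[of _ _ _ _ "\<lambda>j. 2 * q1 j"] sps_potential_scale[of _ _ _ _ 2 q1]
      sps_potential_scale[of _ _ _ _ "dt / 2" "L ?s"] by (rule refl)
  finally have "P i - p1 i = - dt / 2 * (2 * L q1 i + dt / 2 * L (L ?s) i)"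
    using cayley(1)[OF i] by simp
  thus "?s i + dt\<^sup>2 / 4 * L (L ?s) i = 2 * p1 i - dt * L q1 i"
    by (simp add: field_simps power2_eq_square)
qed

text \<open>Writing \<open>U = u + w\<close> in the form of \<open>A + U\<close> at the shifted data
  produces \<open>2 * w * (p1^2 + q1^2)\<close>, which meets \<open>- 2 * R * w\<close> from the
  wave part; the last term is their sum.\<close>

lemma energy_step:
  "energy a b M P Q U V = mesh a b M * (\<Sum>i = 1..M - 1.
     2 * (p1 i * sps_potential a b M u p1 i + q1 i * sps_potential a b M u q1 i)
     + u i * (A u i - u i) - 4 * (v1 i)\<^sup>2
     - 2 * C1\<^sup>2 * (e1 i)\<^sup>2 * (w i * (2 * dt - (d 1)\<^sup>2 - (d 0)\<^sup>2)))"
proof -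
  have "energy a b M P Q U V = mesh a b M *
      (2 * (\<Sum>i = 1..M - 1. P i * L P i + Q i * L Q i) + (\<Sum>i = 1..M - 1. U i * (A U i - U i) - 4 * (V i)\<^sup>2))"
    unfolding energy_eq_sum[OF ab] sum_distrib_left[of 2] sum.distrib[symmetric]
    by (rule arg_cong) (rule sum.cong, auto)
  also have "\<dots> = mesh a b M * (2 * (\<Sum>i = 1..M - 1. p1 i * L p1 i + q1 i * L q1 i) +
      (\<Sum>i = 1..M - 1. u i * (A u i - u i) - 4 * (v1 i)\<^sup>2 - 2 * R i * w i))"
    unfolding potential_energy_conserved wave_energy ..
  also have "\<dots> = mesh a b M * (\<Sum>i = 1..M - 1.
     2 * (p1 i * sps_potential a b M u p1 i + q1 i * sps_potential a b M u q1 i)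
     + u i * (A u i - u i) - 4 * (v1 i)\<^sup>2
     - 2 * C1\<^sup>2 * (e1 i)\<^sup>2 * (w i * (2 * dt - (d 1)\<^sup>2 - (d 0)\<^sup>2)))"
    unfolding sum_distrib_left[of 2] sum.distrib[symmetric]
    by (rule arg_cong, rule sum.cong) (auto simp: sps_potential_def algebra_simps power2_eq_square)
  finally show ?thesis .
qed

end

section \<open>Square integrability\<close>

definition square_integrable :: "'w measure \<Rightarrow> ('w \<Rightarrow> real) \<Rightarrow> bool" where
  "square_integrable N f \<longleftrightarrow> f \<in> borel_measurable N \<and> integrable N (\<lambda>x. (f x)\<^sup>2)"

lemma square_integrable_mult:
  assumes "square_integrable N f" "square_integrable N g"
  shows "integrable N (\<lambda>x. f x * g x)"
proof (rule Bochner_Integration.integrable_bound)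
  show "integrable N (\<lambda>x. (f x)\<^sup>2 + (g x)\<^sup>2)"
    "(\<lambda>x. f x * g x) \<in> borel_measurable N"
    using assms by (auto simp: square_integrable_def)
  have "\<bar>y * z\<bar> \<le> y\<^sup>2 + z\<^sup>2" for y z :: real
  proof -
    have "2 * (\<bar>y\<bar> * \<bar>z\<bar>) \<le> y\<^sup>2 + z\<^sup>2" using sum_squares_bound[of "\<bar>y\<bar>" "\<bar>z\<bar>"] by simp
    moreover have "0 \<le> \<bar>y\<bar> * \<bar>z\<bar>" by simp
    ultimately show ?thesis unfolding abs_mult by linarith
  qed
  thus "AE x in N. norm (f x * g x) \<le> norm ((f x)\<^sup>2 + (g x)\<^sup>2)" by auto
qed

lemma square_integrable_bound:
  assumes "square_integrable N g" "f \<in> borel_measurable N"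
    and "\<And>x. x \<in> space N \<Longrightarrow> \<bar>f x\<bar> \<le> \<bar>g x\<bar>"
  shows "square_integrable N f"
  unfolding square_integrable_def
proof
  show "integrable N (\<lambda>x. (f x)\<^sup>2)"
    by (rule Bochner_Integration.integrable_bound[of _ "\<lambda>x. (g x)\<^sup>2"])
      (use assms in \<open>auto simp: square_integrable_def abs_le_square_iff\<close>)
qed fact

lemma square_integrable_scale: "square_integrable N f \<Longrightarrow> square_integrable N (\<lambda>x. c * f x)"
  by (auto simp: square_integrable_def power_mult_distrib)

lemma square_integrable_add:
  assumes "square_integrable N f" "square_integrable N g"
  shows "square_integrable N (\<lambda>x. f x + g x)"
proof -
  have "integrable N (\<lambda>x. (f x)\<^sup>2 + (g x)\<^sup>2 + 2 * (f x * g x))"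
    using assms square_integrable_mult[OF assms] by (auto simp: square_integrable_def)
  moreover have "(\<lambda>x. (f x)\<^sup>2 + (g x)\<^sup>2 + 2 * (f x * g x)) = (\<lambda>x. (f x + g x)\<^sup>2)"
    by (simp add: fun_eq_iff power2_sum)
  ultimately show ?thesis using assms by (auto simp: square_integrable_def)
qed

lemma square_integrable_diff:
  assumes "square_integrable N f" "square_integrable N g"
  shows "square_integrable N (\<lambda>x. f x - g x)"
  using square_integrable_add[OF assms(1) square_integrable_scale[OF assms(2), of "-1"]] by simp

lemma square_integrable_sum:
  "(\<And>i. i \<in> I \<Longrightarrow> square_integrable N (f i)) \<Longrightarrow> square_integrable N (\<lambda>x. \<Sum>i\<in>I. f i x)"
proof (induction I rule: infinite_finite_induct)
  case (insert i I) thus ?case by (auto intro: square_integrable_add)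
qed (auto simp: square_integrable_def)

lemma square_integrable_bound_sum:
  assumes g: "\<And>i. i \<in> I \<Longrightarrow> square_integrable N (g i)" and f: "f \<in> borel_measurable N"
    and le: "\<And>x. x \<in> space N \<Longrightarrow> (f x)\<^sup>2 \<le> (\<Sum>i\<in>I. (g i x)\<^sup>2)"
  shows "square_integrable N f"
  unfolding square_integrable_def
proof
  show "integrable N (\<lambda>x. (f x)\<^sup>2)"
  proof (rule Bochner_Integration.integrable_bound)
    show "integrable N (\<lambda>x. \<Sum>i\<in>I. (g i x)\<^sup>2)"
      using g by (intro Bochner_Integration.integrable_sum) (simp add: square_integrable_def)
    show "AE x in N. norm ((f x)\<^sup>2) \<le> norm (\<Sum>i\<in>I. (g i x)\<^sup>2)"
      using le by (intro AE_I2) (auto intro: order_trans[OF _ abs_ge_self])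
  qed (use f in simp)
qed fact

lemma square_integrable_sps_apply:
  "(\<And>j. j \<in> {1..M - 1} \<Longrightarrow> square_integrable N (\<lambda>\<omega>. x \<omega> j)) \<Longrightarrow>
    square_integrable N (\<lambda>\<omega>. sps_apply a b M (x \<omega>) i)"
  unfolding sps_apply_def by (intro square_integrable_sum square_integrable_scale) auto

lemma borel_measurable_sps_apply:
  "(\<And>j. j \<in> {1..M - 1} \<Longrightarrow> (\<lambda>\<omega>. x \<omega> j) \<in> borel_measurable N) \<Longrightarrow>
    (\<lambda>\<omega>. sps_apply a b M (x \<omega>) i) \<in> borel_measurable N"
  unfolding sps_apply_def by (intro borel_measurable_sum borel_measurable_times) auto

lemma (in prob_space) square_integrable_const: "square_integrable M (\<lambda>_. c)"
  by (simp add: square_integrable_def)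

lemma (in prob_space) square_integrable_imp_integrable:
  "square_integrable M f \<Longrightarrow> integrable M f"
  using square_integrable_mult[OF _ square_integrable_const[of 1]] by simp

lemma (in prob_space) square_integrable_of_square:
  assumes "f \<in> borel_measurable M" "square_integrable M (\<lambda>x. (f x)\<^sup>2)"
  shows "square_integrable M f"
  using assms square_integrable_imp_integrable[OF assms(2)] by (simp add: square_integrable_def)

section \<open>One step of the scheme\<close>

text \<open>Independence of the past enters as factorisation of mixed moments, in place of
  conditional expectations given \<open>F\<close>. The fourth moment needs only to be finite, so
  that squared increments are in L^2.\<close>

locale noise_step = prob_space Pr for Pr :: "'w measure" +
  fixes F F' :: "'w measure" and d :: "nat \<Rightarrow> 'w \<Rightarrow> real" and mom :: "nat \<Rightarrow> real" and dt :: real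
  assumes sub': "subalgebra Pr F'" and sub: "subalgebra F' F"
    and d_meas: "\<And>k. k < 3 \<Longrightarrow> d k \<in> borel_measurable F'"
    and moments: "\<And>f c n. f \<in> borel_measurable F \<Longrightarrow> has_bochner_integral Pr f c \<Longrightarrow>
      has_bochner_integral Pr (\<lambda>\<omega>. f \<omega> * (\<Prod>k<3. d k \<omega> ^ n k)) (c * (\<Prod>k<3. mom (n k)))"
    and mom: "mom 0 = 1" "mom 1 = 0" "mom 2 = dt" "mom 3 = 0"
begin

lemma measurable_F'_Pr: "f \<in> borel_measurable F' \<Longrightarrow> f \<in> borel_measurable Pr"
  by (rule measurable_from_subalg[OF sub'])

lemma measurable_F_F': "f \<in> borel_measurable F \<Longrightarrow> f \<in> borel_measurable F'"
  by (rule measurable_from_subalg[OF sub])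

lemma measurable_F_Pr: "f \<in> borel_measurable F \<Longrightarrow> f \<in> borel_measurable Pr"
  by (intro measurable_F'_Pr measurable_F_F')

lemma space_F': "space F' = space Pr"
  using sub' by (simp add: subalgebra_def)

definition \<zeta> :: "'w \<Rightarrow> real" where "\<zeta> \<omega> = 2 * dt - (d 1 \<omega>)\<^sup>2 - (d 0 \<omega>)\<^sup>2"

lemma moments3:
  "f \<in> borel_measurable F \<Longrightarrow> has_bochner_integral Pr f c \<Longrightarrow>
    has_bochner_integral Pr (\<lambda>\<omega>. f \<omega> * (d 0 \<omega> ^ i * d 1 \<omega> ^ j * d 2 \<omega> ^ l)) (c * (mom i * mom j * mom l))"
  using moments[of f c "(\<lambda>_. 0)(0 := i, 1 := j, 2 := l)"]
  by (simp add: numeral_3_eq_3 numeral_2_eq_2)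

lemma
  assumes "f \<in> borel_measurable F" "has_bochner_integral Pr f c"
  shows moment_d0: "has_bochner_integral Pr (\<lambda>\<omega>. f \<omega> * d 0 \<omega>) 0"
    and moment_d1: "has_bochner_integral Pr (\<lambda>\<omega>. f \<omega> * d 1 \<omega>) 0"
    and moment_d2: "has_bochner_integral Pr (\<lambda>\<omega>. f \<omega> * d 2 \<omega>) 0"
    and moment_d0_square: "has_bochner_integral Pr (\<lambda>\<omega>. f \<omega> * (d 0 \<omega>)\<^sup>2) (c * dt)"
    and moment_d1_square: "has_bochner_integral Pr (\<lambda>\<omega>. f \<omega> * (d 1 \<omega>)\<^sup>2) (c * dt)"
    and moment_d2_square: "has_bochner_integral Pr (\<lambda>\<omega>. f \<omega> * (d 2 \<omega>)\<^sup>2) (c * dt)"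
  using moments3[OF assms, of 1 0 0] moments3[OF assms, of 0 1 0] moments3[OF assms, of 0 0 1]
    moments3[OF assms, of 2 0 0] moments3[OF assms, of 0 2 0] moments3[OF assms, of 0 0 2] mom
  by simp_all

text \<open>\<open>\<zeta>\<close> is even in the increments and has mean zero, so its product with
  a single increment leaves only terms with a first or third moment.\<close>

lemma
  assumes f: "f \<in> borel_measurable F" "has_bochner_integral Pr f c"
  shows moment_\<zeta>: "has_bochner_integral Pr (\<lambda>\<omega>. f \<omega> * \<zeta> \<omega>) 0"
    and moment_d0_\<zeta>: "has_bochner_integral Pr (\<lambda>\<omega>. f \<omega> * d 0 \<omega> * \<zeta> \<omega>) 0"
    and moment_d1_\<zeta>: "has_bochner_integral Pr (\<lambda>\<omega>. f \<omega> * d 1 \<omega> * \<zeta> \<omega>) 0"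
    and moment_d2_\<zeta>: "has_bochner_integral Pr (\<lambda>\<omega>. f \<omega> * d 2 \<omega> * \<zeta> \<omega>) 0"
proof -
  note [intro] = has_bochner_integral_diff has_bochner_integral_mult_right
  note m = moments3[OF f]
  have "has_bochner_integral Pr (\<lambda>\<omega>. 2 * dt * f \<omega> - f \<omega> * (d 1 \<omega>)\<^sup>2 - f \<omega> * (d 0 \<omega>)\<^sup>2)
      (2 * dt * c - c * dt - c * dt)"
    using f moment_d0_square[OF f] moment_d1_square[OF f] by fast
  thus "has_bochner_integral Pr (\<lambda>\<omega>. f \<omega> * \<zeta> \<omega>) 0"
    by (simp add: \<zeta>_def algebra_simps)
  have "has_bochner_integral Pr (\<lambda>\<omega>. 2 * dt * (f \<omega> * d 0 \<omega>) - f \<omega> * (d 0 \<omega> ^ 1 * d 1 \<omega> ^ 2 * d 2 \<omega> ^ 0)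
      - f \<omega> * (d 0 \<omega> ^ 3 * d 1 \<omega> ^ 0 * d 2 \<omega> ^ 0)) (2 * dt * 0 - c * (mom 1 * mom 2 * mom 0) - c * (mom 3 * mom 0 * mom 0))"
    using moment_d0[OF f] m by fast
  thus "has_bochner_integral Pr (\<lambda>\<omega>. f \<omega> * d 0 \<omega> * \<zeta> \<omega>) 0"
    using mom by (simp add: \<zeta>_def algebra_simps power2_eq_square power3_eq_cube)
  have "has_bochner_integral Pr (\<lambda>\<omega>. 2 * dt * (f \<omega> * d 1 \<omega>) - f \<omega> * (d 0 \<omega> ^ 0 * d 1 \<omega> ^ 3 * d 2 \<omega> ^ 0)
      - f \<omega> * (d 0 \<omega> ^ 2 * d 1 \<omega> ^ 1 * d 2 \<omega> ^ 0)) (2 * dt * 0 - c * (mom 0 * mom 3 * mom 0) - c * (mom 2 * mom 1 * mom 0))"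
    using moment_d1[OF f] m by fast
  thus "has_bochner_integral Pr (\<lambda>\<omega>. f \<omega> * d 1 \<omega> * \<zeta> \<omega>) 0"
    using mom by (simp add: \<zeta>_def algebra_simps power2_eq_square power3_eq_cube)
  have "has_bochner_integral Pr (\<lambda>\<omega>. 2 * dt * (f \<omega> * d 2 \<omega>) - f \<omega> * (d 0 \<omega> ^ 0 * d 1 \<omega> ^ 2 * d 2 \<omega> ^ 1)
      - f \<omega> * (d 0 \<omega> ^ 2 * d 1 \<omega> ^ 0 * d 2 \<omega> ^ 1)) (2 * dt * 0 - c * (mom 0 * mom 2 * mom 1) - c * (mom 2 * mom 0 * mom 1))"
    using moment_d2[OF f] m by fast
  thus "has_bochner_integral Pr (\<lambda>\<omega>. f \<omega> * d 2 \<omega> * \<zeta> \<omega>) 0"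
    using mom by (simp add: \<zeta>_def algebra_simps power2_eq_square power3_eq_cube)
qed

lemma d_meas_Pr: "k < 3 \<Longrightarrow> d k \<in> borel_measurable Pr"
  by (intro measurable_F'_Pr d_meas)

text \<open>A product of two L^2 functions is in general only integrable; here the factorisation
  gives \<open>dt\<close> times the second moment of \<open>f\<close>.\<close>

lemma square_integrable_mult_noise:
  assumes f: "f \<in> borel_measurable F" "square_integrable Pr f" and k: "k < 3"
  shows "square_integrable Pr (\<lambda>\<omega>. f \<omega> * d k \<omega>)"
proof -
  have f2: "(\<lambda>\<omega>. (f \<omega>)\<^sup>2) \<in> borel_measurable F"
    "has_bochner_integral Pr (\<lambda>\<omega>. (f \<omega>)\<^sup>2) (expectation (\<lambda>\<omega>. (f \<omega>)\<^sup>2))"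
    using f by (auto simp: square_integrable_def has_bochner_integral_integrable)
  have "k = 0 \<or> k = 1 \<or> k = 2" using k by auto
  hence "integrable Pr (\<lambda>\<omega>. (f \<omega>)\<^sup>2 * (d k \<omega>)\<^sup>2)"
    using moment_d0_square[OF f2] moment_d1_square[OF f2] moment_d2_square[OF f2]
    by (auto simp: has_bochner_integral_iff)
  thus ?thesis
    using f measurable_F_Pr d_meas_Pr[OF k] by (auto simp: square_integrable_def power_mult_distrib)
qed

lemma has_integral_one: "has_bochner_integral Pr (\<lambda>_. 1 :: real) 1"
  using prob_space by (simp add: has_bochner_integral_iff)

lemma square_integrable_noise: "k < 3 \<Longrightarrow> square_integrable Pr (d k)"
  using square_integrable_mult_noise[of "\<lambda>_. 1" k] square_integrable_const[of 1] by simp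

lemma square_integrable_noise_square:
  assumes "k < 2"
  shows "square_integrable Pr (\<lambda>\<omega>. (d k \<omega>)\<^sup>2)"
proof -
  have "k = 0 \<or> k = 1" using assms by auto
  thus ?thesis
    using moments3[OF _ has_integral_one, of 4 0 0] moments3[OF _ has_integral_one, of 0 4 0] d_meas_Pr
    by (auto simp: square_integrable_def has_bochner_integral_iff power_mult[symmetric])
qed

lemma square_integrable_\<zeta>: "square_integrable Pr \<zeta>"
  unfolding \<zeta>_def[abs_def]
  by (intro square_integrable_diff square_integrable_const square_integrable_noise_square) auto

end

lemma charge_integrable:
  assumes "\<And>i. i \<in> {1..M - 1} \<Longrightarrow> square_integrable Pr (\<lambda>\<omega>. P \<omega> i)"
    and "\<And>i. i \<in> {1..M - 1} \<Longrightarrow> square_integrable Pr (\<lambda>\<omega>. Q \<omega> i)"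
    and "a < b"
  shows "integrable Pr (\<lambda>\<omega>. charge a b M (P \<omega>) (Q \<omega>))"
  unfolding charge_def norm_h_square[OF assms(3)]
  using assms(1,2) unfolding square_integrable_def
  by (intro Bochner_Integration.integrable_add integrable_mult_right Bochner_Integration.integrable_sum) auto

lemma has_bochner_integral_sps_apply:
  "(\<And>j. j \<in> {1..M - 1} \<Longrightarrow> has_bochner_integral N (\<lambda>\<omega>. x \<omega> j) (X j)) \<Longrightarrow>
    has_bochner_integral N (\<lambda>\<omega>. sps_apply a b M (x \<omega>) i) (sps_apply a b M X i)"
  unfolding sps_apply_def by (intro has_bochner_integral_sum has_bochner_integral_mult_right) auto

text \<open>The energy contains \<open>u * p^2\<close> and \<open>u * q^2\<close>, which dictates
  squares of \<open>p\<close> and \<open>q\<close> in L^2 next to \<open>u\<close> and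
  \<open>v\<close>. Measurability of \<open>p\<close> and \<open>q\<close> is listed apart since it
  does not follow from that of their squares.\<close>

locale sps_state = prob_space Pr for Pr :: "'w measure" +
  fixes a b :: real and M :: nat and p q u v :: "'w \<Rightarrow> nat \<Rightarrow> real"
  assumes ab: "a < b"
    and old_meas: "\<And>i. i \<in> {1..M - 1} \<Longrightarrow> (\<lambda>\<omega>. p \<omega> i) \<in> borel_measurable Pr"
      "\<And>i. i \<in> {1..M - 1} \<Longrightarrow> (\<lambda>\<omega>. q \<omega> i) \<in> borel_measurable Pr"
    and old: "\<And>i. i \<in> {1..M - 1} \<Longrightarrow> square_integrable Pr (\<lambda>\<omega>. (p \<omega> i)\<^sup>2)"
      "\<And>i. i \<in> {1..M - 1} \<Longrightarrow> square_integrable Pr (\<lambda>\<omega>. (q \<omega> i)\<^sup>2)"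
      "\<And>i. i \<in> {1..M - 1} \<Longrightarrow> square_integrable Pr (\<lambda>\<omega>. u \<omega> i)"
      "\<And>i. i \<in> {1..M - 1} \<Longrightarrow> square_integrable Pr (\<lambda>\<omega>. v \<omega> i)"
begin

abbreviation (input) "A \<equiv> sps_apply a b M"

lemma old_linear:
  assumes "i \<in> {1..M - 1}"
  shows "square_integrable Pr (\<lambda>\<omega>. p \<omega> i)" "square_integrable Pr (\<lambda>\<omega>. q \<omega> i)"
    "square_integrable Pr (\<lambda>\<omega>. A (u \<omega>) i)"
  using assms old old_meas
  by (auto intro: square_integrable_of_square square_integrable_sps_apply[of M])

abbreviation (input) "energy_term \<equiv> \<lambda>x y u v i.
  2 * (x i * sps_potential a b M u x i + y i * sps_potential a b M u y i) + u i * (A u i - u i) - 4 * (v i)\<^sup>2"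

text \<open>Besides the old energy, these are the ingredients of the coefficients that arise when
  the energy is expanded at the shifted data, with \<open>e\<close> taken as
  \<open>e1\<close>.\<close>

lemma old_products_integrable:
  assumes i: "i \<in> {1..M - 1}"
  shows "integrable Pr (\<lambda>\<omega>. energy_term (p \<omega>) (q \<omega>) (u \<omega>) (v \<omega>) i)"
    and "integrable Pr (\<lambda>\<omega>. e i * sps_potential a b M (u \<omega>) (p \<omega>) i + p \<omega> i * sps_potential a b M (u \<omega>) e i)"
    and "integrable Pr (\<lambda>\<omega>. e i * sps_potential a b M (u \<omega>) (q \<omega>) i + q \<omega> i * sps_potential a b M (u \<omega>) e i)"
    and "integrable Pr (\<lambda>\<omega>. v \<omega> i)" "integrable Pr (\<lambda>\<omega>. u \<omega> i)"
proof -
  note [simp] = square_integrable_mult square_integrable_imp_integrable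
  have A: "square_integrable Pr (\<lambda>\<omega>. A (p \<omega>) i)" "square_integrable Pr (\<lambda>\<omega>. A (q \<omega>) i)"
    by (intro square_integrable_sps_apply old_linear; assumption)+
  note sq = old[OF i] old_linear[OF i] A
  have pot: "integrable Pr (\<lambda>\<omega>. sps_potential a b M (u \<omega>) (p \<omega>) i)"
    "integrable Pr (\<lambda>\<omega>. sps_potential a b M (u \<omega>) (q \<omega>) i)"
    unfolding sps_potential_def
    by (intro Bochner_Integration.integrable_add square_integrable_mult square_integrable_imp_integrable sq)+
  have pe: "integrable Pr (\<lambda>\<omega>. p \<omega> i * sps_potential a b M (u \<omega>) e i)"
    "integrable Pr (\<lambda>\<omega>. q \<omega> i * sps_potential a b M (u \<omega>) e i)"
    unfolding sps_potential_def mult.commute[of _ "e i"]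
    by (intro square_integrable_mult square_integrable_add square_integrable_scale square_integrable_const sq)+
  show "integrable Pr (\<lambda>\<omega>. e i * sps_potential a b M (u \<omega>) (p \<omega>) i + p \<omega> i * sps_potential a b M (u \<omega>) e i)"
    "integrable Pr (\<lambda>\<omega>. e i * sps_potential a b M (u \<omega>) (q \<omega>) i + q \<omega> i * sps_potential a b M (u \<omega>) e i)"
    using pot pe by (intro Bochner_Integration.integrable_add integrable_mult_right; simp)+
  show "integrable Pr (\<lambda>\<omega>. v \<omega> i)" "integrable Pr (\<lambda>\<omega>. u \<omega> i)"
    using sq by simp_all
  have "energy_term x y z s i = 2 * (x i * A x i + z i * (x i)\<^sup>2 + y i * A y i + z i * (y i)\<^sup>2)
      + z i * (A z i - z i) - 4 * (s i * s i)" for x y z s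
    by (simp add: sps_potential_def power2_eq_square algebra_simps)
  thus "integrable Pr (\<lambda>\<omega>. energy_term (p \<omega>) (q \<omega>) (u \<omega>) (v \<omega>) i)"
    by (simp only:) (intro Bochner_Integration.integrable_add Bochner_Integration.integrable_diff
        integrable_mult_right square_integrable_mult square_integrable_diff sq)
qed

lemma energy_old_integral:
  "has_bochner_integral Pr (\<lambda>\<omega>. energy a b M (p \<omega>) (q \<omega>) (u \<omega>) (v \<omega>))
    (mesh a b M * (\<Sum>i = 1..M - 1. expectation (\<lambda>\<omega>. energy_term (p \<omega>) (q \<omega>) (u \<omega>) (v \<omega>) i)))"
  unfolding energy_eq_sum[OF ab]
  by (intro has_bochner_integral_mult_right has_bochner_integral_sum has_bochner_integral_integrable
      old_products_integrable)

lemma inner_old_integral: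
  "has_bochner_integral Pr (\<lambda>\<omega>. inner_h a b M (u \<omega>) (e \<odot> e))
    (mesh a b M * (\<Sum>i = 1..M - 1. expectation (\<lambda>\<omega>. u \<omega> i) * (e \<odot> e) i))"
  unfolding inner_h_def
  by (intro has_bochner_integral_mult_right has_bochner_integral_sum has_bochner_integral_mult_left
      has_bochner_integral_integrable old_products_integrable)

end

text \<open>Regularity is assumed of the old vectors only; that of the new ones has to come out of
  the equations.\<close>

locale sps_noise_step = noise_step Pr F F' d mom dt + sps_state Pr a b M p q u v
  for Pr :: "'w measure" and F F' d mom dt and a b :: real and M :: nat
    and p q u v :: "'w \<Rightarrow> nat \<Rightarrow> real" +
  fixes C1 C2 :: real and e1 e2 :: "nat \<Rightarrow> real" and P Q U V :: "'w \<Rightarrow> nat \<Rightarrow> real"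
  assumes dt_pos: "dt > 0"
    and step: "\<And>\<omega>. \<omega> \<in> space Pr \<Longrightarrow> sps_step a b M dt C1 C2 e1 e2 (\<lambda>k. d k \<omega>)
      (p \<omega>) (q \<omega>) (u \<omega>) (v \<omega>) (P \<omega>) (Q \<omega>) (U \<omega>) (V \<omega>)"
    and meas: "\<And>i. i \<in> {1..M - 1} \<Longrightarrow> (\<lambda>\<omega>. p \<omega> i) \<in> borel_measurable F"
      "\<And>i. i \<in> {1..M - 1} \<Longrightarrow> (\<lambda>\<omega>. q \<omega> i) \<in> borel_measurable F"
      "\<And>i. i \<in> {1..M - 1} \<Longrightarrow> (\<lambda>\<omega>. u \<omega> i) \<in> borel_measurable F"
      "\<And>i. i \<in> {1..M - 1} \<Longrightarrow> (\<lambda>\<omega>. v \<omega> i) \<in> borel_measurable F"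
begin

lemma update: "\<omega> \<in> space Pr \<Longrightarrow> sps_update a b dt C1 C2 M e1 e2 (\<lambda>k. d k \<omega>)
    (p \<omega>) (q \<omega>) (u \<omega>) (v \<omega>) (P \<omega>) (Q \<omega>) (U \<omega>) (V \<omega>)"
  by unfold_locales (use step ab dt_pos in auto)

abbreviation (input) "p1 \<equiv> \<lambda>\<omega> i. p \<omega> i + C1 * d 1 \<omega> * e1 i"
abbreviation (input) "q1 \<equiv> \<lambda>\<omega> i. q \<omega> i - C1 * d 0 \<omega> * e1 i"
abbreviation (input) "v1 \<equiv> \<lambda>\<omega> i. v \<omega> i + C2 / 2 * d 2 \<omega> * e2 i"
abbreviation (input) "w \<equiv> \<lambda>\<omega> i. U \<omega> i - u \<omega> i"
abbreviation (input) "wave_rhs \<equiv> \<lambda>\<omega> i. dt * (2 * v1 \<omega> i + dt / 2 * (A (u \<omega>) i - u \<omega> i +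
  ((p \<omega> i)\<^sup>2 + (q \<omega> i)\<^sup>2 + 2 * C1 * e1 i * (p \<omega> i * d 1 \<omega>)
   - 2 * C1 * e1 i * (q \<omega> i * d 0 \<omega>) + 2 * dt * C1\<^sup>2 * (e1 i)\<^sup>2)))"

lemma d_meas': "d 0 \<in> borel_measurable F'" "d 1 \<in> borel_measurable F'" "d 2 \<in> borel_measurable F'"
  using d_meas by auto

lemma meas': assumes "i \<in> {1..M - 1}"
  shows "(\<lambda>\<omega>. p \<omega> i) \<in> borel_measurable F'" "(\<lambda>\<omega>. q \<omega> i) \<in> borel_measurable F'"
    "(\<lambda>\<omega>. u \<omega> i) \<in> borel_measurable F'" "(\<lambda>\<omega>. v \<omega> i) \<in> borel_measurable F'"
    "(\<lambda>\<omega>. A (u \<omega>) i) \<in> borel_measurable F'"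
  using meas assms by (auto intro!: measurable_F_F' borel_measurable_sps_apply)

lemma wave_rhs_measurable: "i \<in> {1..M - 1} \<Longrightarrow> (\<lambda>\<omega>. wave_rhs \<omega> i) \<in> borel_measurable F'"
  using meas'[of i] d_meas' by simp

text \<open>The increment of \<open>U\<close> solves the wave system, whose matrix \<open>?K\<close>
  is the same for all samples and whose right-hand side is \<open>F'\<close>-measurable.\<close>

lemma w_measurable:
  assumes "i \<in> {1..M - 1}"
  shows "(\<lambda>\<omega>. w \<omega> i) \<in> borel_measurable F'"
proof -
  let ?I = "{1..M - 1}"
  let ?K = "\<lambda>i j. (if i = j then 1 + dt\<^sup>2 / 4 else 0) - dt\<^sup>2 / 4 * sps_matrix a b M i j"
  have K: "(\<Sum>j\<in>?I. ?K i j * x j) = x i - dt\<^sup>2 / 4 * (A x i - x i)" if "i \<in> ?I" for x i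
  proof -
    have "(\<Sum>j\<in>?I. ?K i j * x j) = (\<Sum>j\<in>?I. if i = j then (1 + dt\<^sup>2 / 4) * x j else 0) - dt\<^sup>2 / 4 * A x i"
      unfolding sps_apply_def sum_distrib_left sum_subtractf[symmetric]
      by (intro sum.cong refl) (simp add: algebra_simps)
    also have "\<dots> = x i - dt\<^sup>2 / 4 * (A x i - x i)"
      using that by (simp add: field_simps)
    finally show ?thesis .
  qed
  have "\<forall>i\<in>?I. (\<lambda>\<omega>. w \<omega> i) \<in> borel_measurable F'"
  proof (rule coercive_system_measurable[where K = "\<lambda>i j _. ?K i j" and c = "\<lambda>i \<omega>. wave_rhs \<omega> i"])
    fix y :: "nat \<Rightarrow> real"
    have "(\<Sum>i\<in>?I. (y i)\<^sup>2) \<le> (\<Sum>i\<in>?I. y i * (y i - dt\<^sup>2 / 4 * (A y i - y i)))"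
      by (rule wave_operator_coercive[OF ab]) simp
    also have "\<dots> = (\<Sum>i\<in>?I. y i * (\<Sum>j\<in>?I. ?K i j * y j))"
      by (intro sum.cong refl) (simp only: K)
    finally show "(\<Sum>i\<in>?I. (y i)\<^sup>2) \<le> (\<Sum>i\<in>?I. y i * (\<Sum>j\<in>?I. ?K i j * y j))" .
  next
    fix \<omega> i assume \<omega>: "\<omega> \<in> space F'" and i: "i \<in> ?I"
    have \<omega>': "\<omega> \<in> space Pr" using \<omega> space_F' by simp
    show "(\<Sum>j\<in>?I. ?K i j * w \<omega> j) = wave_rhs \<omega> i"
      unfolding K[OF i] by (rule sps_update.wave_system[OF update[OF \<omega>'] i])
  qed (use wave_rhs_measurable in auto)
  thus ?thesis using assms by blast
qed

lemma U_measurable: "i \<in> {1..M - 1} \<Longrightarrow> (\<lambda>\<omega>. U \<omega> i) \<in> borel_measurable F'"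
  using borel_measurable_add[OF w_measurable[of i] meas'(3)[of i]] by simp

lemma V_eq:
  assumes "\<omega> \<in> space Pr" "i \<in> {1..M - 1}"
  shows "V \<omega> i = 1 / dt * w \<omega> i - v1 \<omega> i"
  using sps_update.velocity(1)[OF update[OF assms(1)] assms(2)] by simp

lemma V_measurable:
  assumes "i \<in> {1..M - 1}"
  shows "(\<lambda>\<omega>. V \<omega> i) \<in> borel_measurable F'"
proof (subst measurable_cong)
  show "V \<omega> i = 1 / dt * w \<omega> i - v1 \<omega> i" if "\<omega> \<in> space F'" for \<omega>
    using V_eq assms that space_F' by simp
  show "(\<lambda>\<omega>. 1 / dt * w \<omega> i - v1 \<omega> i) \<in> borel_measurable F'"
    using w_measurable[OF assms] meas'[OF assms] d_meas' by simp
qed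

lemma potential_measurable:
  assumes "\<And>j. j \<in> {1..M - 1} \<Longrightarrow> (\<lambda>\<omega>. x \<omega> j) \<in> borel_measurable F'" and "i \<in> {1..M - 1}"
  shows "(\<lambda>\<omega>. sps_potential a b M (U \<omega>) (x \<omega>) i) \<in> borel_measurable F'"
  unfolding sps_potential_def using assms U_measurable
  by (intro borel_measurable_add borel_measurable_times borel_measurable_sps_apply) auto

lemma
  assumes "i \<in> {1..M - 1}"
  shows p1_measurable: "(\<lambda>\<omega>. p1 \<omega> i) \<in> borel_measurable F'"
    and q1_measurable: "(\<lambda>\<omega>. q1 \<omega> i) \<in> borel_measurable F'"
  using meas'[OF assms] d_meas' by simp_all

text \<open>The matrix of \<open>1 + dt^2 / 4 * (A + U)^2\<close> depends on the sample through
  \<open>U\<close> alone, and \<open>U\<close> is already known to be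
  \<open>F'\<close>-measurable.\<close>

lemma P_sum_measurable:
  assumes "i \<in> {1..M - 1}"
  shows "(\<lambda>\<omega>. P \<omega> i + p1 \<omega> i) \<in> borel_measurable F'"
proof -
  let ?I = "{1..M - 1}"
  let ?L = "\<lambda>i j \<omega>. sps_matrix a b M i j + (if i = j then U \<omega> i else 0)"
  let ?K = "\<lambda>i j \<omega>. (if i = j then 1 else 0) + dt\<^sup>2 / 4 * (\<Sum>l\<in>?I. ?L i l \<omega> * ?L l j \<omega>)"
  have L: "(\<Sum>j\<in>?I. ?L i j \<omega> * x j) = sps_potential a b M (U \<omega>) x i" if "i \<in> ?I" for x i \<omega>
  proof -
    have "(\<Sum>j\<in>?I. ?L i j \<omega> * x j) = A x i + (\<Sum>j\<in>?I. if i = j then U \<omega> j * x j else 0)"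
      unfolding sps_apply_def sum.distrib[symmetric]
      by (intro sum.cong refl) (simp add: algebra_simps)
    thus ?thesis using that by (simp add: sps_potential_def)
  qed
  have K: "(\<Sum>j\<in>?I. ?K i j \<omega> * x j) =
      x i + dt\<^sup>2 / 4 * sps_potential a b M (U \<omega>) (sps_potential a b M (U \<omega>) x) i" if "i \<in> ?I" for x i \<omega>
  proof -
    have "(\<Sum>j\<in>?I. ?K i j \<omega> * x j) = (\<Sum>j\<in>?I. if i = j then x j else 0)
        + dt\<^sup>2 / 4 * (\<Sum>j\<in>?I. \<Sum>l\<in>?I. ?L i l \<omega> * (?L l j \<omega> * x j))"
      unfolding sum_distrib_left sum.distrib[symmetric]
      by (intro sum.cong refl) (simp add: distrib_right sum_distrib_left sum_distrib_right mult.assoc)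
    also have "(\<Sum>j\<in>?I. \<Sum>l\<in>?I. ?L i l \<omega> * (?L l j \<omega> * x j)) =
        (\<Sum>l\<in>?I. ?L i l \<omega> * sps_potential a b M (U \<omega>) x l)"
      by (subst sum.swap, intro sum.cong refl) (simp only: L[symmetric] sum_distrib_left)
    finally show ?thesis using that by (simp only: L) simp
  qed
  let ?c = "\<lambda>i \<omega>. 2 * p1 \<omega> i - dt * sps_potential a b M (U \<omega>) (q1 \<omega>) i"
  have "\<forall>i\<in>?I. (\<lambda>\<omega>. P \<omega> i + p1 \<omega> i) \<in> borel_measurable F'"
  proof (rule coercive_system_measurable[where K = ?K and c = ?c])
    fix \<omega> and y :: "nat \<Rightarrow> real"
    let ?LL = "sps_potential a b M (U \<omega>)"
    have "(\<Sum>i\<in>?I. y i * (\<Sum>j\<in>?I. ?K i j \<omega> * y j)) =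
        (\<Sum>i\<in>?I. y i * (y i + dt\<^sup>2 / 4 * ?LL (?LL y) i))"
      by (intro sum.cong refl) (simp only: K)
    also have "\<dots> = (\<Sum>i\<in>?I. y i * y i) + dt\<^sup>2 / 4 * (\<Sum>i\<in>?I. y i * ?LL (?LL y) i)"
      by (simp add: distrib_left sum.distrib sum_distrib_left mult_ac)
    \<comment> \<open>Symmetry turns the form of the squared operator into a sum of squares, so
      coercivity holds whatever the sign of \<open>U\<close>.\<close>
    also have "(\<Sum>i\<in>?I. y i * ?LL (?LL y) i) = (\<Sum>i\<in>?I. ?LL y i * ?LL y i)"
      by (rule sps_potential_self_adjoint)
    finally show "(\<Sum>i\<in>?I. (y i)\<^sup>2) \<le> (\<Sum>i\<in>?I. y i * (\<Sum>j\<in>?I. ?K i j \<omega> * y j))"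
      by (simp add: power2_eq_square sum_nonneg)
  next
    fix \<omega> i assume \<omega>: "\<omega> \<in> space F'" and i: "i \<in> ?I"
    have \<omega>': "\<omega> \<in> space Pr" using \<omega> space_F' by simp
    show "(\<Sum>j\<in>?I. ?K i j \<omega> * (P \<omega> j + p1 \<omega> j)) = ?c i \<omega>"
      unfolding K[OF i] by (rule sps_update.schroedinger_system(1)[OF update[OF \<omega>'] i])
  next
    show "?K i j \<in> borel_measurable F'" if "i \<in> ?I" "j \<in> ?I" for i j
      using U_measurable that
      by (intro borel_measurable_add borel_measurable_times borel_measurable_sum borel_measurable_const
          measurable_If) auto
    show "?c i \<in> borel_measurable F'" if "i \<in> ?I" for i
      using p1_measurable[OF that] potential_measurable[OF q1_measurable that]
      by (intro borel_measurable_diff borel_measurable_times borel_measurable_const)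
  qed simp
  thus ?thesis using assms by blast
qed

lemma P_measurable: "i \<in> {1..M - 1} \<Longrightarrow> (\<lambda>\<omega>. P \<omega> i) \<in> borel_measurable F'"
  using borel_measurable_diff[OF P_sum_measurable[of i] p1_measurable[of i]] by simp

lemma Q_measurable:
  assumes "i \<in> {1..M - 1}"
  shows "(\<lambda>\<omega>. Q \<omega> i) \<in> borel_measurable F'"
proof (subst measurable_cong)
  let ?s = "\<lambda>\<omega> j. P \<omega> j + p1 \<omega> j"
  show "Q \<omega> i = q1 \<omega> i + dt / 2 * sps_potential a b M (U \<omega>) (?s \<omega>) i" if "\<omega> \<in> space F'" for \<omega>
    using that space_F' by (intro sps_update.schroedinger_system(2)[OF update assms]) simp
  show "(\<lambda>\<omega>. q1 \<omega> i + dt / 2 * sps_potential a b M (U \<omega>) (?s \<omega>) i) \<in> borel_measurable F'"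
    using q1_measurable[OF assms] potential_measurable[OF P_sum_measurable assms]
    by (intro borel_measurable_add borel_measurable_times borel_measurable_const)
qed

lemma wave_rhs_square_integrable:
  assumes i: "i \<in> {1..M - 1}"
  shows "square_integrable Pr (\<lambda>\<omega>. wave_rhs \<omega> i)"
proof -
  have "square_integrable Pr (\<lambda>\<omega>. dt * (2 * (v \<omega> i + C2 / 2 * e2 i * d 2 \<omega>)
     + dt / 2 * (A (u \<omega>) i - u \<omega> i +
     ((p \<omega> i)\<^sup>2 + (q \<omega> i)\<^sup>2 + 2 * C1 * e1 i * (p \<omega> i * d 1 \<omega>)
     - 2 * C1 * e1 i * (q \<omega> i * d 0 \<omega>) + 2 * dt * C1\<^sup>2 * (e1 i)\<^sup>2))))"
    using old[OF i] old_linear[OF i] meas[OF i]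
    by (intro square_integrable_scale square_integrable_add square_integrable_diff
        square_integrable_const square_integrable_mult_noise square_integrable_noise) simp_all
  thus ?thesis by (simp add: mult_ac)
qed

lemma U_square_integrable:
  assumes i: "i \<in> {1..M - 1}"
  shows "square_integrable Pr (\<lambda>\<omega>. w \<omega> i)" "square_integrable Pr (\<lambda>\<omega>. U \<omega> i)"
proof -
  show w: "square_integrable Pr (\<lambda>\<omega>. w \<omega> i)"
  proof (rule square_integrable_bound_sum)
    show "square_integrable Pr (\<lambda>\<omega>. wave_rhs \<omega> j)" if "j \<in> {1..M - 1}" for j
      by (rule wave_rhs_square_integrable[OF that])
    show "(w \<omega> i)\<^sup>2 \<le> (\<Sum>j = 1..M - 1. (wave_rhs \<omega> j)\<^sup>2)" if "\<omega> \<in> space Pr" for \<omega>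
      by (rule sps_update.wave_bound[OF update[OF that] i])
    show "(\<lambda>\<omega>. w \<omega> i) \<in> borel_measurable Pr"
      by (rule measurable_F'_Pr[OF w_measurable[OF i]])
  qed
  show "square_integrable Pr (\<lambda>\<omega>. U \<omega> i)"
    using square_integrable_add[OF w old(3)[OF i]] by simp
qed

lemma V_square_integrable:
  assumes i: "i \<in> {1..M - 1}"
  shows "square_integrable Pr (\<lambda>\<omega>. V \<omega> i)"
proof -
  have "square_integrable Pr (\<lambda>\<omega>. 1 / dt * w \<omega> i - (v \<omega> i + C2 / 2 * e2 i * d 2 \<omega>))"
    using old[OF i] U_square_integrable[OF i]
    by (intro square_integrable_scale square_integrable_add square_integrable_diff square_integrable_noise) simp_all
  thus ?thesis
    by (rule square_integrable_bound) (use V_eq i measurable_F'_Pr[OF V_measurable[OF i]] in \<open>auto simp: mult_ac\<close>)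
qed

lemma shifted_square_integrable:
  assumes i: "i \<in> {1..M - 1}"
  shows "square_integrable Pr (\<lambda>\<omega>. (p1 \<omega> i)\<^sup>2)" "square_integrable Pr (\<lambda>\<omega>. (q1 \<omega> i)\<^sup>2)"
proof -
  have "square_integrable Pr (\<lambda>\<omega>. (p \<omega> i)\<^sup>2 + 2 * C1 * e1 i * (p \<omega> i * d 1 \<omega>) + (C1 * e1 i)\<^sup>2 * (d 1 \<omega>)\<^sup>2)"
    "square_integrable Pr (\<lambda>\<omega>. (q \<omega> i)\<^sup>2 - 2 * C1 * e1 i * (q \<omega> i * d 0 \<omega>) + (C1 * e1 i)\<^sup>2 * (d 0 \<omega>)\<^sup>2)"
    using old[OF i] old_linear[OF i] meas[OF i]
    by (intro square_integrable_scale square_integrable_add square_integrable_diff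
        square_integrable_mult_noise square_integrable_noise_square; simp)+
  thus "square_integrable Pr (\<lambda>\<omega>. (p1 \<omega> i)\<^sup>2)" "square_integrable Pr (\<lambda>\<omega>. (q1 \<omega> i)\<^sup>2)"
    by (simp_all add: power2_eq_square algebra_simps)
qed

text \<open>Charge conservation dominates \<open>P^2\<close> and \<open>Q^2\<close> on every path by
  the shifted charge. Fourth moments therefore survive although the possibly unbounded
  \<open>U\<close> sits in the Schroedinger system.\<close>

lemma new_square_integrable:
  assumes i: "i \<in> {1..M - 1}"
  shows "square_integrable Pr (\<lambda>\<omega>. (P \<omega> i)\<^sup>2)" "square_integrable Pr (\<lambda>\<omega>. (Q \<omega> i)\<^sup>2)"
proof -
  let ?g = "\<lambda>\<omega>. \<Sum>j = 1..M - 1. (p1 \<omega> j)\<^sup>2 + (q1 \<omega> j)\<^sup>2"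
  have g: "square_integrable Pr ?g"
    using shifted_square_integrable by (intro square_integrable_sum square_integrable_add) auto
  have le: "(P \<omega> i)\<^sup>2 + (Q \<omega> i)\<^sup>2 \<le> ?g \<omega>" if "\<omega> \<in> space Pr" for \<omega>
    unfolding sps_update.charge_conserved[OF update[OF that], symmetric]
    by (rule member_le_sum[OF i, of "\<lambda>i. (P \<omega> i)\<^sup>2 + (Q \<omega> i)\<^sup>2"]) auto
  have "\<bar>(P \<omega> i)\<^sup>2\<bar> \<le> \<bar>?g \<omega>\<bar>" "\<bar>(Q \<omega> i)\<^sup>2\<bar> \<le> \<bar>?g \<omega>\<bar>" if "\<omega> \<in> space Pr" for \<omega>
    using le[OF that] by (smt (verit) zero_le_power2)+
  thus "square_integrable Pr (\<lambda>\<omega>. (P \<omega> i)\<^sup>2)" "square_integrable Pr (\<lambda>\<omega>. (Q \<omega> i)\<^sup>2)"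
    using P_measurable[OF i] Q_measurable[OF i]
    by (intro square_integrable_bound[OF g]; simp add: measurable_F'_Pr)+
qed

lemma charge_increment:
  "has_bochner_integral Pr (\<lambda>\<omega>. charge a b M (P \<omega>) (Q \<omega>))
    (expectation (\<lambda>\<omega>. charge a b M (p \<omega>) (q \<omega>)) + 2 * C1\<^sup>2 * (norm_h a b M e1)\<^sup>2 * dt)"
proof -
  let ?E = "\<lambda>i. expectation (\<lambda>\<omega>. (p \<omega> i)\<^sup>2 + (q \<omega> i)\<^sup>2)"
  have new_term: "has_bochner_integral Pr (\<lambda>\<omega>. (p1 \<omega> i)\<^sup>2 + (q1 \<omega> i)\<^sup>2) (?E i + 2 * C1\<^sup>2 * (e1 i)\<^sup>2 * dt)"
    and old_term: "has_bochner_integral Pr (\<lambda>\<omega>. (p \<omega> i)\<^sup>2 + (q \<omega> i)\<^sup>2) (?E i)"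
    if i: "i \<in> {1..M - 1}" for i
  proof -
    note pq = has_bochner_integral_integrable[OF square_integrable_imp_integrable[OF old_linear(1)[OF i]]]
      has_bochner_integral_integrable[OF square_integrable_imp_integrable[OF old_linear(2)[OF i]]]
    show pq2: "has_bochner_integral Pr (\<lambda>\<omega>. (p \<omega> i)\<^sup>2 + (q \<omega> i)\<^sup>2) (?E i)"
      using old_linear[OF i] by (auto simp: square_integrable_def intro!: has_bochner_integral_integrable)
    \<comment> \<open>The factors 1 make the pure squares instances of the moment rules with
      constant \<open>f\<close>, and signs sit in the coefficients so that only sums occur.\<close>
    have "has_bochner_integral Pr (\<lambda>\<omega>. (p \<omega> i)\<^sup>2 + (q \<omega> i)\<^sup>2 +
        2 * C1 * e1 i * (p \<omega> i * d 1 \<omega>) + (-2 * C1 * e1 i) * (q \<omega> i * d 0 \<omega>)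
        + (C1 * e1 i)\<^sup>2 * (1 * (d 1 \<omega>)\<^sup>2) + (C1 * e1 i)\<^sup>2 * (1 * (d 0 \<omega>)\<^sup>2))
      (?E i + 2 * C1 * e1 i * 0 + (-2 * C1 * e1 i) * 0 + (C1 * e1 i)\<^sup>2 * (1 * dt) + (C1 * e1 i)\<^sup>2 * (1 * dt))"
      by (intro has_bochner_integral_add has_bochner_integral_mult_right pq2
          moment_d1[OF meas(1)[OF i] pq(1)] moment_d0[OF meas(2)[OF i] pq(2)]
          moment_d1_square moment_d0_square has_integral_one borel_measurable_const)
    moreover have "(\<lambda>\<omega>. (p \<omega> i)\<^sup>2 + (q \<omega> i)\<^sup>2 +
        2 * C1 * e1 i * (p \<omega> i * d 1 \<omega>) + (-2 * C1 * e1 i) * (q \<omega> i * d 0 \<omega>)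
        + (C1 * e1 i)\<^sup>2 * (1 * (d 1 \<omega>)\<^sup>2) + (C1 * e1 i)\<^sup>2 * (1 * (d 0 \<omega>)\<^sup>2)) = (\<lambda>\<omega>. (p1 \<omega> i)\<^sup>2 + (q1 \<omega> i)\<^sup>2)"
      by (simp add: fun_eq_iff power2_eq_square algebra_simps)
    moreover have "?E i + 2 * C1 * e1 i * 0 + (-2 * C1 * e1 i) * 0 + (C1 * e1 i)\<^sup>2 * (1 * dt) + (C1 * e1 i)\<^sup>2 * (1 * dt)
        = ?E i + 2 * C1\<^sup>2 * (e1 i)\<^sup>2 * dt"
      by (simp add: power_mult_distrib)
    ultimately show "has_bochner_integral Pr (\<lambda>\<omega>. (p1 \<omega> i)\<^sup>2 + (q1 \<omega> i)\<^sup>2) (?E i + 2 * C1\<^sup>2 * (e1 i)\<^sup>2 * dt)"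
      by (simp only:)
  qed
  have charge: "charge a b M x y = mesh a b M * (\<Sum>i = 1..M - 1. (x i)\<^sup>2 + (y i)\<^sup>2)" for x y
    by (simp add: charge_def norm_h_square[OF ab] sum.distrib distrib_left)
  have "has_bochner_integral Pr (\<lambda>\<omega>. charge a b M (p \<omega>) (q \<omega>)) (mesh a b M * (\<Sum>i = 1..M - 1. ?E i))"
    unfolding charge by (intro has_bochner_integral_mult_right has_bochner_integral_sum old_term)
  hence E: "expectation (\<lambda>\<omega>. charge a b M (p \<omega>) (q \<omega>)) = mesh a b M * (\<Sum>i = 1..M - 1. ?E i)"
    by (rule has_bochner_integral_integral_eq)
  have "has_bochner_integral Pr (\<lambda>\<omega>. mesh a b M * (\<Sum>i = 1..M - 1. (p1 \<omega> i)\<^sup>2 + (q1 \<omega> i)\<^sup>2))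
      (mesh a b M * (\<Sum>i = 1..M - 1. ?E i + 2 * C1\<^sup>2 * (e1 i)\<^sup>2 * dt))"
    by (intro has_bochner_integral_mult_right has_bochner_integral_sum new_term)
  moreover have "mesh a b M * (\<Sum>i = 1..M - 1. ?E i + 2 * C1\<^sup>2 * (e1 i)\<^sup>2 * dt) =
      expectation (\<lambda>\<omega>. charge a b M (p \<omega>) (q \<omega>)) + 2 * C1\<^sup>2 * (norm_h a b M e1)\<^sup>2 * dt"
    unfolding E norm_h_square[OF ab]
    by (simp add: sum.distrib distrib_left sum_distrib_left sum_distrib_right mult_ac)
  moreover have "charge a b M (P \<omega>) (Q \<omega>) = mesh a b M * (\<Sum>i = 1..M - 1. (p1 \<omega> i)\<^sup>2 + (q1 \<omega> i)\<^sup>2)"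
    if "\<omega> \<in> space Pr" for \<omega>
    unfolding charge sps_update.charge_conserved[OF update[OF that]] ..
  ultimately show ?thesis
    by (subst has_bochner_integral_cong[OF refl _ refl]) auto
qed

text \<open>The right-hand side is an \<open>F\<close>-measurable part plus single increments with
  \<open>F\<close>-measurable coefficients, and \<open>\<zeta>\<close> is orthogonal to each of
  these. A squared increment would break this.\<close>

lemma wave_rhs_\<zeta>:
  assumes i: "i \<in> {1..M - 1}"
  shows "has_bochner_integral Pr (\<lambda>\<omega>. wave_rhs \<omega> i * \<zeta> \<omega>) 0"
proof -
  let ?f = "\<lambda>\<omega>. dt * (2 * v \<omega> i + dt / 2 * (A (u \<omega>) i - u \<omega> i +
    ((p \<omega> i)\<^sup>2 + (q \<omega> i)\<^sup>2 + 2 * dt * C1\<^sup>2 * (e1 i)\<^sup>2)))"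
  have sq: "square_integrable Pr ?f"
    by (intro square_integrable_scale square_integrable_add square_integrable_diff
        square_integrable_const old[OF i] old_linear[OF i])
  have mf: "?f \<in> borel_measurable F"
    using meas[OF i] borel_measurable_sps_apply[where x = u and N = F, OF meas(3)] by simp
  note I = has_bochner_integral_integrable[OF square_integrable_imp_integrable]
  have "has_bochner_integral Pr (\<lambda>\<omega>. ?f \<omega> * \<zeta> \<omega> + dt * C2 * e2 i * (1 * d 2 \<omega> * \<zeta> \<omega>)
      + dt * dt * C1 * e1 i * (p \<omega> i * d 1 \<omega> * \<zeta> \<omega>) + (- (dt * dt * C1 * e1 i)) * (q \<omega> i * d 0 \<omega> * \<zeta> \<omega>))
      (0 + dt * C2 * e2 i * 0 + dt * dt * C1 * e1 i * 0 + (- (dt * dt * C1 * e1 i)) * 0)"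
    by (intro has_bochner_integral_add has_bochner_integral_mult_right moment_\<zeta>[OF mf I[OF sq]]
        moment_d2_\<zeta>[OF borel_measurable_const has_integral_one]
        moment_d1_\<zeta>[OF meas(1)[OF i] I[OF old_linear(1)[OF i]]]
        moment_d0_\<zeta>[OF meas(2)[OF i] I[OF old_linear(2)[OF i]]])
  moreover have "(\<lambda>\<omega>. ?f \<omega> * \<zeta> \<omega> + dt * C2 * e2 i * (1 * d 2 \<omega> * \<zeta> \<omega>)
      + dt * dt * C1 * e1 i * (p \<omega> i * d 1 \<omega> * \<zeta> \<omega>) + (- (dt * dt * C1 * e1 i)) * (q \<omega> i * d 0 \<omega> * \<zeta> \<omega>))
      = (\<lambda>\<omega>. wave_rhs \<omega> i * \<zeta> \<omega>)"
    by (rule ext) (simp add: field_simps)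
  ultimately show ?thesis by simp
qed

text \<open>Taking expectations in the linear system for \<open>w\<close> multiplied by \<open>\<zeta>\<close> gives a homogeneous
  coercive system for the vector of the expectations of \<open>w i * \<zeta>\<close>.\<close>

lemma w_\<zeta>:
  assumes "i \<in> {1..M - 1}"
  shows "has_bochner_integral Pr (\<lambda>\<omega>. w \<omega> i * \<zeta> \<omega>) 0"
proof -
  let ?W = "\<lambda>i. expectation (\<lambda>\<omega>. w \<omega> i * \<zeta> \<omega>)"
  have W: "has_bochner_integral Pr (\<lambda>\<omega>. w \<omega> i * \<zeta> \<omega>) (?W i)" if "i \<in> {1..M - 1}" for i
    by (intro has_bochner_integral_integrable square_integrable_mult square_integrable_\<zeta> U_square_integrable that)
  have "?W i - dt\<^sup>2 / 4 * (A ?W i - ?W i) = 0" if i: "i \<in> {1..M - 1}" for i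
  proof -
    let ?f = "\<lambda>\<omega>. w \<omega> i * \<zeta> \<omega> - dt\<^sup>2 / 4 * (A (\<lambda>j. w \<omega> j * \<zeta> \<omega>) i - w \<omega> i * \<zeta> \<omega>)"
    have "has_bochner_integral Pr ?f (?W i - dt\<^sup>2 / 4 * (A ?W i - ?W i))"
      by (intro has_bochner_integral_diff has_bochner_integral_mult_right W[OF i]
          has_bochner_integral_sps_apply[of M, OF W])
    moreover have "?f \<omega> = wave_rhs \<omega> i * \<zeta> \<omega>" if "\<omega> \<in> space Pr" for \<omega>
    proof -
      have "A (\<lambda>j. w \<omega> j * \<zeta> \<omega>) i = A (w \<omega>) i * \<zeta> \<omega>"
        using sps_apply_scale[of a b M "\<zeta> \<omega>" "w \<omega>" i] by (simp add: mult.commute)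
      hence "?f \<omega> = (w \<omega> i - dt\<^sup>2 / 4 * (A (w \<omega>) i - w \<omega> i)) * \<zeta> \<omega>"
        by (simp add: algebra_simps)
      thus ?thesis unfolding sps_update.wave_system[OF update[OF that] i] .
    qed
    ultimately have "has_bochner_integral Pr (\<lambda>\<omega>. wave_rhs \<omega> i * \<zeta> \<omega>) (?W i - dt\<^sup>2 / 4 * (A ?W i - ?W i))"
      by (subst has_bochner_integral_cong[OF refl _ refl, of _ _ ?f]) auto
    thus ?thesis using wave_rhs_\<zeta>[OF i] by (rule has_bochner_integral_eq)
  qed
  hence "(\<Sum>i = 1..M - 1. ?W i * (?W i - dt\<^sup>2 / 4 * (A ?W i - ?W i))) = 0"
    by (intro sum.neutral ballI) simp
  hence "(\<Sum>i = 1..M - 1. (?W i)\<^sup>2) \<le> 0"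
    using wave_operator_coercive[OF ab, of "dt\<^sup>2 / 4" ?W M] by simp
  moreover have "(?W i)\<^sup>2 \<le> (\<Sum>i = 1..M - 1. (?W i)\<^sup>2)"
    by (rule member_le_sum[OF assms, of "\<lambda>i. (?W i)\<^sup>2"]) auto
  ultimately have "?W i = 0" by (smt (verit) zero_less_power2)
  thus ?thesis using W[OF assms] by simp
qed

text \<open>Linear terms average to zero. Each of the squares of \<open>d 1\<close> and
  \<open>d 0\<close> carries \<open>2 * C1^2\<close> times \<open>e1 * (A + u) e1\<close>, whence
  the factor 4 and the value of \<open>u\<close> at the old level; \<open>- 4 * (C2 / 2)^2\<close>
  is the \<open>- C2^2\<close> of the wave noise.\<close>

lemma energy_term_increment:
  assumes i: "i \<in> {1..M - 1}"
  shows "has_bochner_integral Pr (\<lambda>\<omega>. energy_term (p1 \<omega>) (q1 \<omega>) (u \<omega>) (v1 \<omega>) i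
      - 2 * C1\<^sup>2 * (e1 i)\<^sup>2 * (w \<omega> i * \<zeta> \<omega>))
    (expectation (\<lambda>\<omega>. energy_term (p \<omega>) (q \<omega>) (u \<omega>) (v \<omega>) i)
      + 4 * C1\<^sup>2 * dt * (e1 i * A e1 i + (e1 i)\<^sup>2 * expectation (\<lambda>\<omega>. u \<omega> i)) - C2\<^sup>2 * dt * (e2 i)\<^sup>2)"
proof -
  let ?E = "expectation (\<lambda>\<omega>. energy_term (p \<omega>) (q \<omega>) (u \<omega>) (v \<omega>) i)"
  let ?fp = "\<lambda>\<omega>. e1 i * sps_potential a b M (u \<omega>) (p \<omega>) i + p \<omega> i * sps_potential a b M (u \<omega>) e1 i"
  let ?fq = "\<lambda>\<omega>. e1 i * sps_potential a b M (u \<omega>) (q \<omega>) i + q \<omega> i * sps_potential a b M (u \<omega>) e1 i"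
  let ?g = "\<lambda>\<omega>. e1 i * A e1 i + (e1 i)\<^sup>2 * u \<omega> i"
  let ?G = "e1 i * A e1 i + (e1 i)\<^sup>2 * expectation (\<lambda>\<omega>. u \<omega> i)"
  note I = old_products_integrable[OF i, THEN has_bochner_integral_integrable]
  have mA: "(\<lambda>\<omega>. A (p \<omega>) i) \<in> borel_measurable F" "(\<lambda>\<omega>. A (q \<omega>) i) \<in> borel_measurable F"
    by (intro borel_measurable_sps_apply meas; assumption)+
  have mf: "?fp \<in> borel_measurable F" "?fq \<in> borel_measurable F" and mg: "?g \<in> borel_measurable F"
    using meas[OF i] mA unfolding sps_potential_def by simp_all
  have g: "has_bochner_integral Pr ?g ?G"
    using has_bochner_integral_add[OF has_bochner_integral_mult_right[OF has_integral_one, of "e1 i * A e1 i"]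
        has_bochner_integral_mult_right[OF I(5), of "(e1 i)\<^sup>2"]] by simp
  have "has_bochner_integral Pr (\<lambda>\<omega>. energy_term (p \<omega>) (q \<omega>) (u \<omega>) (v \<omega>) i
      + 2 * C1 * (?fp \<omega> * d 1 \<omega>) + (- 2 * C1) * (?fq \<omega> * d 0 \<omega>)
      + 2 * C1\<^sup>2 * (?g \<omega> * (d 1 \<omega>)\<^sup>2) + 2 * C1\<^sup>2 * (?g \<omega> * (d 0 \<omega>)\<^sup>2)
      + (- 4 * C2 * e2 i) * (v \<omega> i * d 2 \<omega>) + (- C2\<^sup>2 * (e2 i)\<^sup>2) * (1 * (d 2 \<omega>)\<^sup>2)
      + (- 2 * C1\<^sup>2 * (e1 i)\<^sup>2) * (w \<omega> i * \<zeta> \<omega>))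
      (?E + 2 * C1 * 0 + (- 2 * C1) * 0 + 2 * C1\<^sup>2 * (?G * dt) + 2 * C1\<^sup>2 * (?G * dt)
      + (- 4 * C2 * e2 i) * 0 + (- C2\<^sup>2 * (e2 i)\<^sup>2) * (1 * dt) + (- 2 * C1\<^sup>2 * (e1 i)\<^sup>2) * 0)"
    by (intro has_bochner_integral_add has_bochner_integral_mult_right I(1)
        moment_d1[OF mf(1) I(2)] moment_d0[OF mf(2) I(3)] moment_d1_square[OF mg g] moment_d0_square[OF mg g]
        moment_d2[OF meas(4)[OF i] I(4)] moment_d2_square[OF borel_measurable_const has_integral_one] w_\<zeta>[OF i])
  moreover have "energy_term (p \<omega>) (q \<omega>) (u \<omega>) (v \<omega>) i
      + 2 * C1 * (?fp \<omega> * d 1 \<omega>) + (- 2 * C1) * (?fq \<omega> * d 0 \<omega>)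
      + 2 * C1\<^sup>2 * (?g \<omega> * (d 1 \<omega>)\<^sup>2) + 2 * C1\<^sup>2 * (?g \<omega> * (d 0 \<omega>)\<^sup>2)
      + (- 4 * C2 * e2 i) * (v \<omega> i * d 2 \<omega>) + (- C2\<^sup>2 * (e2 i)\<^sup>2) * (1 * (d 2 \<omega>)\<^sup>2)
      + (- 2 * C1\<^sup>2 * (e1 i)\<^sup>2) * (w \<omega> i * \<zeta> \<omega>) =
      energy_term (p1 \<omega>) (q1 \<omega>) (u \<omega>) (v1 \<omega>) i - 2 * C1\<^sup>2 * (e1 i)\<^sup>2 * (w \<omega> i * \<zeta> \<omega>)" for \<omega>
    unfolding sps_potential_def sps_apply_add sps_apply_diff sps_apply_scale
    by (simp add: power2_eq_square algebra_simps)
  moreover have "?E + 2 * C1 * 0 + (- 2 * C1) * 0 + 2 * C1\<^sup>2 * (?G * dt) + 2 * C1\<^sup>2 * (?G * dt)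
      + (- 4 * C2 * e2 i) * 0 + (- C2\<^sup>2 * (e2 i)\<^sup>2) * (1 * dt) + (- 2 * C1\<^sup>2 * (e1 i)\<^sup>2) * 0
      = ?E + 4 * C1\<^sup>2 * dt * ?G - C2\<^sup>2 * dt * (e2 i)\<^sup>2"
    by (simp add: algebra_simps)
  ultimately show ?thesis by (simp only:)
qed

lemma energy_increment:
  "has_bochner_integral Pr (\<lambda>\<omega>. energy a b M (P \<omega>) (Q \<omega>) (U \<omega>) (V \<omega>))
    (expectation (\<lambda>\<omega>. energy a b M (p \<omega>) (q \<omega>) (u \<omega>) (v \<omega>))
      - C2\<^sup>2 * (norm_h a b M e2)\<^sup>2 * dt + 4 * C1\<^sup>2 * inner_h a b M e1 (A e1) * dt
      + 4 * C1\<^sup>2 * (expectation (\<lambda>\<omega>. inner_h a b M (u \<omega>) (e1 \<odot> e1)) * dt))"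
proof -
  let ?E = "\<lambda>i. expectation (\<lambda>\<omega>. energy_term (p \<omega>) (q \<omega>) (u \<omega>) (v \<omega>) i)"
  let ?T = "\<lambda>i. ?E i + 4 * C1\<^sup>2 * dt * (e1 i * A e1 i + (e1 i)\<^sup>2 * expectation (\<lambda>\<omega>. u \<omega> i)) - C2\<^sup>2 * dt * (e2 i)\<^sup>2"
  let ?f = "\<lambda>\<omega>. mesh a b M * (\<Sum>i = 1..M - 1. energy_term (p1 \<omega>) (q1 \<omega>) (u \<omega>) (v1 \<omega>) i
      - 2 * C1\<^sup>2 * (e1 i)\<^sup>2 * (w \<omega> i * \<zeta> \<omega>))"
  have "has_bochner_integral Pr ?f (mesh a b M * (\<Sum>i = 1..M - 1. ?T i))"
    by (intro has_bochner_integral_mult_right has_bochner_integral_sum energy_term_increment)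
  moreover have "mesh a b M * (\<Sum>i = 1..M - 1. ?T i) =
    expectation (\<lambda>\<omega>. energy a b M (p \<omega>) (q \<omega>) (u \<omega>) (v \<omega>))
      - C2\<^sup>2 * (norm_h a b M e2)\<^sup>2 * dt + 4 * C1\<^sup>2 * inner_h a b M e1 (A e1) * dt
      + 4 * C1\<^sup>2 * (expectation (\<lambda>\<omega>. inner_h a b M (u \<omega>) (e1 \<odot> e1)) * dt)"
    unfolding has_bochner_integral_integral_eq[OF energy_old_integral]
      has_bochner_integral_integral_eq[OF inner_old_integral] norm_h_square[OF ab]
    unfolding inner_h_def cprod_def sum_distrib_left sum_distrib_right
      sum.distrib[symmetric] sum_subtractf[symmetric]
    by (intro sum.cong refl) (simp add: algebra_simps power2_eq_square)
  moreover have "energy a b M (P \<omega>) (Q \<omega>) (U \<omega>) (V \<omega>) = ?f \<omega>" if "\<omega> \<in> space Pr" for \<omega>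
    unfolding \<zeta>_def by (rule sps_update.energy_step[OF update[OF that]])
  ultimately show ?thesis
    by (subst has_bochner_integral_cong[OF refl _ refl]) auto
qed

end

section \<open>The filtration of the noise\<close>

text \<open>The probability of an intersection factors in three stages: \<open>E0\<close> against
  all noise in \<open>H\<close>, the rows against each other through \<open>G\<close>, and the
  entries within a row. As every family contains the whole space, intersections over the full index
  set suffice.\<close>

lemma (in prob_space) indep_sets_option_times:
  assumes fin: "finite K" "finite J" "K \<noteq> {}" "J \<noteq> {}"
    and rows: "\<And>k. k \<in> K \<Longrightarrow> indep_sets (E k) J"
    and rowG: "\<And>k j. k \<in> K \<Longrightarrow> j \<in> J \<Longrightarrow> E k j \<subseteq> sets (G k)"
    and columns: "indep_sets (\<lambda>k. sets (G k)) K"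
    and allH: "\<And>k j. k \<in> K \<Longrightarrow> j \<in> J \<Longrightarrow> E k j \<subseteq> sets H"
    and start: "indep_set E0 (sets H)"
    and space: "space M \<in> E0" "\<And>k j. k \<in> K \<Longrightarrow> j \<in> J \<Longrightarrow> space M \<in> E k j"
  shows "indep_sets (case_option E0 (\<lambda>(k, j). E k j)) (insert None (Some ` (K \<times> J)))"
proof (subst indep_sets_finite)
  have E: "E k j \<subseteq> events" if "k \<in> K" "j \<in> J" for k j
    using rows[OF that(1)] that(2) by (auto simp: indep_sets_def)
  show "case_option E0 (\<lambda>(k, j). E k j) i \<subseteq> events" if "i \<in> insert None (Some ` (K \<times> J))" for i
    using that E indep_setD_ev1[OF start] by (elim insertE imageE SigmaE; simp)
  show "space M \<in> case_option E0 (\<lambda>(k, j). E k j) i" if "i \<in> insert None (Some ` (K \<times> J))" for i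
    using that space by auto
  show "\<forall>A\<in>Pi (insert None (Some ` (K \<times> J))) (case_option E0 (\<lambda>(k, j). E k j)).
      prob (\<Inter>i\<in>insert None (Some ` (K \<times> J)). A i) = (\<Prod>i\<in>insert None (Some ` (K \<times> J)). prob (A i))"
  proof
    fix A assume A: "A \<in> Pi (insert None (Some ` (K \<times> J))) (case_option E0 (\<lambda>(k, j). E k j))"
    hence AE: "A (Some (k, j)) \<in> E k j" if "k \<in> K" "j \<in> J" for k j
      using that by (auto simp: Pi_iff)
    have A0: "A None \<in> E0" using A by (auto simp: Pi_iff)
    have "prob (\<Inter>i\<in>insert None (Some ` (K \<times> J)). A i) = prob (A None \<inter> (\<Inter>k\<in>K. \<Inter>j\<in>J. A (Some (k, j))))"
      by (rule arg_cong[where f = prob]) auto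
    also have "\<dots> = prob (A None) * prob (\<Inter>k\<in>K. \<Inter>j\<in>J. A (Some (k, j)))"
      using fin AE allH by (intro indep_setD[OF start A0] sets.finite_INT) blast+
    also have "prob (\<Inter>k\<in>K. \<Inter>j\<in>J. A (Some (k, j))) = (\<Prod>k\<in>K. prob (\<Inter>j\<in>J. A (Some (k, j))))"
      using fin AE rowG by (intro indep_setsD[OF columns] ballI sets.finite_INT) blast+
    also have "\<dots> = (\<Prod>k\<in>K. \<Prod>j\<in>J. prob (A (Some (k, j))))"
      using fin AE by (intro prod.cong refl indep_setsD[OF rows] ballI) auto
    also have "\<dots> = (\<Prod>i\<in>Some ` (K \<times> J). prob (A i))"
      by (simp add: prod.cartesian_product prod.reindex case_prod_unfold)
    also have "prob (A None) * \<dots> = (\<Prod>i\<in>insert None (Some ` (K \<times> J)). prob (A i))"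
      using fin by (subst prod.insert) auto
    finally show "prob (\<Inter>i\<in>insert None (Some ` (K \<times> J)). A i) = (\<Prod>i\<in>insert None (Some ` (K \<times> J)). prob (A i))" .
  qed
qed (use fin in auto)

lemma normal_moments:
  fixes dt :: real
  assumes "dt > 0"
  defines "mom \<equiv> \<lambda>n. integral\<^sup>L lborel (\<lambda>x. normal_density 0 (sqrt dt) x * x ^ n)"
  shows "mom 0 = 1" "mom 1 = 0" "mom 2 = dt" "mom 3 = 0"
proof -
  have s: "0 < sqrt dt" using assms by simp
  show "mom 0 = 1" "mom 1 = 0" "mom 2 = dt" "mom 3 = 0"
    using integral_normal_moment_even[OF s, of 0 0] integral_normal_moment_even[OF s, of 0 1]
      integral_normal_moment_odd[of "sqrt dt" 0 0] integral_normal_moment_odd[of "sqrt dt" 0 1] assms(1)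
    by (simp_all add: mom_def numeral_3_eq_3 numeral_2_eq_2)
qed

lemma (in prob_space) normal_power_integral:
  assumes \<sigma>: "\<sigma> > 0" and D: "distributed M lborel X (normal_density 0 \<sigma>)"
  shows "has_bochner_integral M (\<lambda>x. X x ^ n) (integral\<^sup>L lborel (\<lambda>x. normal_density 0 \<sigma> x * x ^ n))"
  using distributed_integrable[OF D, of "\<lambda>x. x ^ n"] distributed_integral[OF D, of "\<lambda>x. x ^ n"]
    integrable_normal_moment[OF \<sigma>, of 0 n]
  by (simp add: has_bochner_integral_iff)

lemma (in prob_space) indep_vars_of_indep_sets:
  assumes "indep_sets S I" and "\<And>i. i \<in> I \<Longrightarrow> X i \<in> measurable (G i) (N i)"
    and "\<And>i. i \<in> I \<Longrightarrow> space (G i) = space M" and "\<And>i. i \<in> I \<Longrightarrow> sets (G i) \<subseteq> S i"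
  shows "indep_vars N X I"
  unfolding indep_vars_def2
proof
  have ev: "S i \<subseteq> events" if "i \<in> I" for i using assms(1) that by (auto simp: indep_sets_def)
  show "\<forall>i\<in>I. random_variable (N i) (X i)"
  proof
    fix i assume i: "i \<in> I"
    show "random_variable (N i) (X i)"
      by (rule measurable_from_subalg[OF _ assms(2)[OF i]])
        (use assms(3,4)[OF i] ev[OF i] in \<open>auto simp: subalgebra_def\<close>)
  qed
  show "indep_sets (\<lambda>i. {X i -` A \<inter> space M |A. A \<in> sets (N i)}) I"
    using assms(1)
  proof (rule indep_sets_mono_sets)
    fix i assume i: "i \<in> I"
    show "{X i -` A \<inter> space M |A. A \<in> sets (N i)} \<subseteq> S i"
      using measurable_sets[OF assms(2)[OF i]] assms(3,4)[OF i] by auto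
  qed
qed

text \<open>\<open>None\<close> indexes the initial data and \<open>Some (k, m)\<close> the
  \<open>m\<close>-th increment of the \<open>k\<close>-th process. In one common family, past and
  present of each step are disjoint blocks.\<close>

locale noise_filtration = prob_space Pr for Pr :: "'w measure" +
  fixes X :: "'w measure" and d :: "nat \<Rightarrow> nat \<Rightarrow> 'w \<Rightarrow> real" and N :: nat and dt :: real
  assumes spaceX: "space X = space Pr"
    and family: "indep_sets (case_option (sets X) (\<lambda>(k, m). sets (vimage_algebra (space Pr) (d k m) borel)))
      (insert None (Some ` ({..<3} \<times> {..<N})))"
    and normal: "\<And>k m. k < 3 \<Longrightarrow> m < N \<Longrightarrow> distributed Pr lborel (d k m) (normal_density 0 (sqrt dt))"
    and dt_pos: "dt > 0"
begin

definition gen :: "(nat \<times> nat) option \<Rightarrow> 'w set set" where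
  "gen = case_option (sets X) (\<lambda>(k, m). sets (vimage_algebra (space Pr) (d k m) borel))"

definition past :: "nat \<Rightarrow> (nat \<times> nat) option set" where
  "past n = insert None (Some ` ({..<3} \<times> {..<n}))"

definition filtration :: "nat \<Rightarrow> 'w measure" where
  "filtration n = sigma (space Pr) (\<Union>i\<in>past n. gen i)"

lemma indep_gen: "indep_sets gen (past N)"
  using family by (simp add: gen_def past_def)

lemma gen_events: "i \<in> past N \<Longrightarrow> gen i \<subseteq> events"
  using indep_gen unfolding indep_sets_def by blast

lemma gen_Pow: "gen i \<subseteq> Pow (space Pr)"
proof (cases i)
  case None thus ?thesis using sets.sets_into_space[of _ X] spaceX by (auto simp: gen_def)
next
  case (Some km) thus ?thesis
    using sets.sets_into_space[of _ "vimage_algebra (space Pr) (d (fst km) (snd km)) borel"]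
    by (auto simp: gen_def case_prod_unfold)
qed

lemma gen_Int_stable: "Int_stable (gen i)"
  by (cases i) (simp_all add: gen_def sets.Int_stable case_prod_unfold)

lemma space_filtration [simp]: "space (filtration n) = space Pr"
  unfolding filtration_def using gen_Pow by (intro space_measure_of) blast

lemma sets_filtration: "sets (filtration n) = sigma_sets (space Pr) (\<Union>i\<in>past n. gen i)"
  unfolding filtration_def using gen_Pow by (intro sets_measure_of) blast

lemma gen_filtration: "i \<in> past n \<Longrightarrow> gen i \<subseteq> sets (filtration n)"
  unfolding sets_filtration by (blast intro: sigma_sets.Basic)

lemma past_mono: "m \<le> n \<Longrightarrow> past m \<subseteq> past n"
  by (auto simp: past_def)

lemma filtration_subalgebra:
  assumes "n \<le> N" shows "subalgebra Pr (filtration n)"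
proof -
  have "(\<Union>i\<in>past n. gen i) \<subseteq> events"
    using gen_events past_mono[OF assms] by blast
  thus ?thesis
    by (simp add: subalgebra_def sets_filtration sets.sigma_sets_subset)
qed

lemma filtration_mono:
  assumes "m \<le> n" shows "subalgebra (filtration n) (filtration m)"
proof -
  have "(\<Union>i\<in>past m. gen i) \<subseteq> (\<Union>i\<in>past n. gen i)"
    using past_mono[OF assms] by blast
  thus ?thesis
    by (simp add: subalgebra_def sets_filtration sigma_sets_mono')
qed

lemma filtration_start:
  assumes "f \<in> measurable X N'" shows "f \<in> measurable (filtration n) N'"
proof (rule measurable_from_subalg[OF _ assms])
  have "gen None \<subseteq> sets (filtration n)"
    by (rule gen_filtration) (simp add: past_def)
  thus "subalgebra (filtration n) X"
    by (simp add: subalgebra_def spaceX gen_def)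
qed

lemma noise_measurable:
  assumes "k < 3" "m < n" shows "d k m \<in> borel_measurable (filtration n)"
proof (rule measurable_from_subalg)
  have "gen (Some (k, m)) \<subseteq> sets (filtration n)"
    using assms by (intro gen_filtration) (simp add: past_def)
  thus "subalgebra (filtration n) (vimage_algebra (space Pr) (d k m) borel)"
    by (simp add: subalgebra_def gen_def)
  show "d k m \<in> borel_measurable (vimage_algebra (space Pr) (d k m) borel)"
    by (rule measurable_vimage_algebra1) simp
qed

text \<open>Sigma-algebras generated by disjoint blocks of an independent family are independent, so
  the expectation splits into a factor for the past and one for each of the three
  increments.\<close>

lemma noise_step_at:
  assumes n: "n < N"
  shows "noise_step Pr (filtration n) (filtration (Suc n)) (\<lambda>k. d k n)
    (\<lambda>l. integral\<^sup>L lborel (\<lambda>x. normal_density 0 (sqrt dt) x * x ^ l)) dt"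
proof
  let ?mom = "\<lambda>l. integral\<^sup>L lborel (\<lambda>x. normal_density 0 (sqrt dt) x * x ^ l)"
  show "?mom 0 = 1" "?mom 1 = 0" "?mom 2 = dt" "?mom 3 = 0"
    using normal_moments[OF dt_pos] by simp_all
  show "subalgebra Pr (filtration (Suc n))" using n by (intro filtration_subalgebra) simp
  show "subalgebra (filtration (Suc n)) (filtration n)" by (rule filtration_mono) simp
  show "d k n \<in> borel_measurable (filtration (Suc n))" if "k < 3" for k
    using that by (rule noise_measurable) simp
  fix f :: "'w \<Rightarrow> real" and c and l :: "nat \<Rightarrow> nat"
  assume f: "f \<in> borel_measurable (filtration n)" "has_bochner_integral Pr f c"
  \<comment> \<open>Slots 0, 1, 2 hold the increments of step \<open>n\<close>; slot 3 holds the
    whole past.\<close>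
  let ?I = "\<lambda>j. if j = 3 then past n else {Some (j, n)}"
  let ?G = "\<lambda>j. sigma (space Pr) (\<Union>i\<in>?I j. gen i)"
  have sub: "(\<Union>j<4. ?I j) \<subseteq> past N"
    using n by (auto simp: past_def split: if_splits)
  have G: "sets (?G j) = sigma_sets (space Pr) (\<Union>i\<in>?I j. gen i)" for j
    using gen_Pow by (intro sets_measure_of) blast
  have spG: "space (?G j) = space Pr" for j
    using gen_Pow by (intro space_measure_of) blast
  have indep: "indep_sets (\<lambda>j. sigma_sets (space Pr) (\<Union>i\<in>?I j. gen i)) {..<4}"
  proof (rule indep_sets_collect_sigma)
    show "indep_sets gen (\<Union>j<4. ?I j)"
      by (rule indep_sets_mono_index[OF sub indep_gen])
    show "disjoint_family_on ?I {..<4}"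
      by (auto simp: disjoint_family_on_def past_def split: if_splits)
  qed (rule gen_Int_stable)
  have "indep_vars (\<lambda>_. borel) (\<lambda>j. if j = 3 then f else d j n) {..<4}"
  proof (rule indep_vars_of_indep_sets[OF indep, of _ ?G])
    fix j :: nat assume j: "j \<in> {..<4}"
    show "(if j = 3 then f else d j n) \<in> borel_measurable (?G j)"
    proof (cases "j = 3")
      case True thus ?thesis using f by (simp add: filtration_def)
    next
      case False
      have "d j n \<in> borel_measurable (?G j)"
      proof (rule measurable_from_subalg)
        show "subalgebra (?G j) (vimage_algebra (space Pr) (d j n) borel)"
          using False unfolding subalgebra_def G spG by (auto simp: gen_def intro: sigma_sets.Basic)
        show "d j n \<in> borel_measurable (vimage_algebra (space Pr) (d j n) borel)"
          by (rule measurable_vimage_algebra1) simp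
      qed
      thus ?thesis using False by simp
    qed
  qed (simp_all add: G spG)
  hence "indep_vars (\<lambda>_. borel) (\<lambda>j \<omega>. (if j = 3 then (\<lambda>x. x) else (\<lambda>x. x ^ l j)) ((if j = 3 then f else d j n) \<omega>)) {..<4}"
    by (rule indep_vars_compose2) auto
  also have "(\<lambda>j \<omega>. (if j = 3 then (\<lambda>x. x) else (\<lambda>x. x ^ l j)) ((if j = 3 then f else d j n) \<omega>)) =
      (\<lambda>j \<omega>. if j = 3 then f \<omega> else d j n \<omega> ^ l j)"
    by (simp add: fun_eq_iff)
  finally have iv: "indep_vars (\<lambda>_. borel) (\<lambda>j \<omega>. if j = 3 then f \<omega> else d j n \<omega> ^ l j) {..<4}" .
  have pw: "has_bochner_integral Pr (\<lambda>\<omega>. d j n \<omega> ^ l j) (?mom (l j))" if "j < 3" for j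
    using that n dt_pos by (intro normal_power_integral normal) auto
  have int: "integrable Pr (\<lambda>\<omega>. if j = 3 then f \<omega> else d j n \<omega> ^ l j)" if "j \<in> {..<4}" for j
    using that f(2) pw[of j] by (cases "j = 3") (auto simp: has_bochner_integral_iff)
  have four: "{..<4} = insert 3 {..<3 :: nat}" by auto
  have prod4: "(\<Prod>j<4. if j = 3 then x else y j) = x * (\<Prod>j<3. y j)" for x and y :: "nat \<Rightarrow> real"
    unfolding four by (subst prod.insert) (auto intro!: prod.cong)
  have "has_bochner_integral Pr (\<lambda>\<omega>. \<Prod>j<4. if j = 3 then f \<omega> else d j n \<omega> ^ l j)
      (\<Prod>j<4. expectation (\<lambda>\<omega>. if j = 3 then f \<omega> else d j n \<omega> ^ l j))"
    using indep_vars_lebesgue_integral[OF _ iv int] indep_vars_integrable[OF _ iv int]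
    by (simp add: has_bochner_integral_iff)
  also have "(\<Prod>j<4. expectation (\<lambda>\<omega>. if j = 3 then f \<omega> else d j n \<omega> ^ l j)) =
      (\<Prod>j<4. if j = 3 then c else ?mom (l j))"
  proof (rule prod.cong[OF refl])
    fix j :: nat assume "j \<in> {..<4}"
    thus "expectation (\<lambda>\<omega>. if j = 3 then f \<omega> else d j n \<omega> ^ l j) = (if j = 3 then c else ?mom (l j))"
      using has_bochner_integral_integral_eq[OF f(2)] has_bochner_integral_integral_eq[OF pw[of j]]
      by (cases "j = 3") auto
  qed
  finally show "has_bochner_integral Pr (\<lambda>\<omega>. f \<omega> * (\<Prod>k<3. d k n \<omega> ^ l k)) (c * (\<Prod>k<3. ?mom (l k)))"
    unfolding prod4 .
qed

end

text \<open>An increment is a function of one path and of the joint path, hence measurable for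
  \<open>G k\<close> and \<open>H\<close>. These carry the independence of the processes from each
  other and from the initial data.\<close>

lemma std_wiener_noise_filtration:
  assumes prob: "prob_space Pr"
    and wiener: "\<And>k. k \<in> {0, 1, 2 :: nat} \<Longrightarrow> std_wiener Pr (B k)"
    and wiener_indep:
      "prob_space.indep_vars Pr (\<lambda>_. \<Pi>\<^sub>M t\<in>{0..}. borel) (\<lambda>k \<omega>. \<lambda>t\<in>{0..}. B k t \<omega>) {0, 1, 2}"
    and spaceX: "space X = space Pr"
    and init_indep: "prob_space.indep_set Pr (sets X)
         (sets (vimage_algebra (space Pr) (\<lambda>\<omega>. \<lambda>(k, t)\<in>{0, 1, 2} \<times> {0..}. B k t \<omega>)
            (\<Pi>\<^sub>M kt\<in>{0, 1, 2} \<times> {0..}. borel)))"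
    and dt: "dt > 0" and N: "N > 0"
  shows "noise_filtration Pr X (\<lambda>k m \<omega>. B k (real (Suc m) * dt) \<omega> - B k (real m * dt) \<omega>) N dt"
proof -
  interpret prob_space Pr by fact
  define d where "d k m \<omega> = B k (real (Suc m) * dt) \<omega> - B k (real m * dt) \<omega>" for k m \<omega>
  have three: "{..<3} = {0, 1, 2 :: nat}" by auto
  define G where "G k = vimage_algebra (space Pr) (\<lambda>\<omega>. \<lambda>t\<in>{0..}. B k t \<omega>) (\<Pi>\<^sub>M t\<in>{0 :: real..}. (borel :: real measure))" for k
  define H where "H = vimage_algebra (space Pr) (\<lambda>\<omega>. \<lambda>(k, t)\<in>{0, 1, 2} \<times> {0..}. B k t \<omega>)
            (\<Pi>\<^sub>M kt\<in>{0, 1, 2 :: nat} \<times> {0 :: real..}. (borel :: real measure))"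
  define E where "E k m = sets (vimage_algebra (space Pr) (d k m) borel)" for k m
  have BG: "B k t \<in> borel_measurable (G k)" if "t \<ge> 0" for k t
  proof -
    have "(\<lambda>\<omega>. (\<lambda>t\<in>{0..}. B k t \<omega>) t) \<in> borel_measurable (G k)"
      unfolding G_def using that
      by (intro measurable_compose[OF measurable_vimage_algebra1 measurable_component_singleton])
        (auto simp: space_PiM restrict_PiE_iff simp del: restrict_apply)
    thus ?thesis using that by simp
  qed
  have BH: "B k t \<in> borel_measurable H" if "t \<ge> 0" "k \<in> {0, 1, 2}" for k t
  proof -
    have "(\<lambda>\<omega>. (\<lambda>(k, t)\<in>{0, 1, 2} \<times> {0..}. B k t \<omega>) (k, t)) \<in> borel_measurable H"
      unfolding H_def using that
      by (intro measurable_compose[OF measurable_vimage_algebra1 measurable_component_singleton])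
        (auto simp: space_PiM restrict_PiE_iff simp del: restrict_apply)
    thus ?thesis using that by simp
  qed
  have E_sub: "E k m \<subseteq> sets N'" if "space N' = space Pr" "d k m \<in> borel_measurable N'" for k m N'
    unfolding E_def using that by (intro sets_image_in_sets) auto
  have "indep_sets (case_option (sets X) (\<lambda>(k, m). E k m)) (insert None (Some ` ({..<3} \<times> {..<N})))"
  proof (rule indep_sets_option_times[where G = G and H = H])
    show "indep_sets (E k) {..<N}" if "k \<in> {..<3}" for k
    proof -
      have "indep_vars (\<lambda>_. borel) (\<lambda>i \<omega>. B k (real (Suc i) * dt) \<omega> - B k (real i * dt) \<omega>) {..<N}"
      proof -
        have "\<forall>n t. 0 \<le> t 0 \<longrightarrow> (\<forall>i<n. t i < t (Suc i)) \<longrightarrow>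
            indep_vars (\<lambda>_. borel) (\<lambda>i \<omega>. B k (t (Suc i)) \<omega> - B k (t i) \<omega>) {..<n}"
          using wiener[of k] that unfolding std_wiener_def three by blast
        from this[rule_format, of "\<lambda>i. real i * dt" N] show ?thesis using dt by simp
      qed
      hence "indep_vars (\<lambda>_. borel) (d k) {..<N}" by (simp add: d_def[abs_def])
      thus ?thesis unfolding indep_vars_def2 E_def by (simp add: sets_vimage_algebra2)
    qed
    show "E k m \<subseteq> sets (G k)" for k m
    proof (rule E_sub)
      show "space (G k) = space Pr" by (simp add: G_def)
      show "d k m \<in> borel_measurable (G k)"
        unfolding d_def[abs_def] using dt by (intro borel_measurable_diff BG) simp_all
    qed
    show "indep_sets (\<lambda>k. sets (G k)) {..<3}"
    proof -
      have "sets (G k) = {(\<lambda>\<omega>. \<lambda>t\<in>{0..}. B k t \<omega>) -` A \<inter> space Pr | A. A \<in> sets (\<Pi>\<^sub>M t\<in>{0 :: real..}. (borel :: real measure))}" for k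
        unfolding G_def by (rule sets_vimage_algebra2) (auto simp: space_PiM restrict_PiE_iff simp del: restrict_apply)
      thus ?thesis using wiener_indep unfolding indep_vars_def2 three by simp
    qed
    show "E k m \<subseteq> sets H" if "k \<in> {..<3}" for k m
    proof (rule E_sub)
      show "space H = space Pr" by (simp add: H_def)
      show "d k m \<in> borel_measurable H"
        unfolding d_def[abs_def] using dt that three by (intro borel_measurable_diff BH) simp_all
    qed
    show "indep_set (sets X) (sets H)" using init_indep by (simp add: H_def)
    show "space Pr \<in> sets X" using sets.top[of X] spaceX by simp
    show "space Pr \<in> E k m" for k m
      unfolding E_def using sets.top[of "vimage_algebra (space Pr) (d k m) borel"] by simp
  qed (use N in \<open>auto simp: lessThan_empty_iff\<close>)
  moreover have "distributed Pr lborel (d k m) (normal_density 0 (sqrt dt))" if "k < 3" for k m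
  proof -
    have "k \<in> {0, 1, 2}" using that by auto
    hence "\<forall>s t. 0 \<le> s \<longrightarrow> s < t \<longrightarrow>
        distributed Pr lborel (\<lambda>\<omega>. B k t \<omega> - B k s \<omega>) (normal_density 0 (sqrt (t - s)))"
      using wiener[of k] unfolding std_wiener_def by blast
    hence "distributed Pr lborel (\<lambda>\<omega>. B k (real (Suc m) * dt) \<omega> - B k (real m * dt) \<omega>)
        (normal_density 0 (sqrt (real (Suc m) * dt - real m * dt)))"
      using dt by simp
    thus ?thesis by (simp add: d_def[abs_def] algebra_simps)
  qed
  ultimately have "noise_filtration Pr X d N dt"
    using spaceX dt by unfold_locales (auto simp: E_def)
  thus ?thesis by (simp add: d_def[abs_def])
qed

section \<open>Induction over the time levels\<close>

theorem mainTheorem8: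
  fixes Pr :: "'w measure"
    and B :: "nat \<Rightarrow> real \<Rightarrow> 'w \<Rightarrow> real"
    and a b C1 C2 T dt :: real
    and \<eta>1 \<eta>2 :: "real \<Rightarrow> real"
    and M N :: nat
    and P Q U V :: "nat \<Rightarrow> 'w \<Rightarrow> nat \<Rightarrow> real"
  defines "A \<equiv> sps_apply a b M"
    and "e1 \<equiv> grid_fun a b M \<eta>1"
    and "e2 \<equiv> grid_fun a b M \<eta>2"
    and "S \<equiv> (\<Pi>\<^sub>M i\<in>{1..M - 1}. (borel :: real measure))"
  assumes prob: "prob_space Pr"
    and wiener: "\<And>k. k \<in> {0, 1, 2} \<Longrightarrow> std_wiener Pr (B k)"
    and wiener_indep:
      "prob_space.indep_vars Pr (\<lambda>_. \<Pi>\<^sub>M t\<in>{0..}. borel) (\<lambda>k \<omega>. \<lambda>t\<in>{0..}. B k t \<omega>) {0, 1, 2}"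
    and ab: "a < b" and M: "M \<ge> 1" and T: "T > 0" and dt: "dt > 0"
    and N: "N = nat \<lfloor>T / dt\<rfloor>"
    and init_indep:
      "prob_space.indep_set Pr
         (sets (vimage_algebra (space Pr)
            (\<lambda>\<omega>. (restrict (P 0 \<omega>) {1..M - 1}, restrict (Q 0 \<omega>) {1..M - 1},
                  restrict (U 0 \<omega>) {1..M - 1}, restrict (V 0 \<omega>) {1..M - 1}))
            (S \<Otimes>\<^sub>M S \<Otimes>\<^sub>M S \<Otimes>\<^sub>M S)))
         (sets (vimage_algebra (space Pr)
            (\<lambda>\<omega>. \<lambda>(k, t)\<in>{0, 1, 2} \<times> {0..}. B k t \<omega>)
            (\<Pi>\<^sub>M kt\<in>{0, 1, 2} \<times> {0..}. borel)))"
    and init_moments: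
      "\<And>i. i \<in> {1..M - 1} \<Longrightarrow> integrable Pr (\<lambda>\<omega>. (P 0 \<omega> i) ^ 4)"
      "\<And>i. i \<in> {1..M - 1} \<Longrightarrow> integrable Pr (\<lambda>\<omega>. (Q 0 \<omega> i) ^ 4)"
      "\<And>i. i \<in> {1..M - 1} \<Longrightarrow> integrable Pr (\<lambda>\<omega>. (U 0 \<omega> i) ^ 2)"
      "\<And>i. i \<in> {1..M - 1} \<Longrightarrow> integrable Pr (\<lambda>\<omega>. (V 0 \<omega> i) ^ 2)"
    and scheme:
      "\<And>n \<omega>. n \<in> {1..N} \<Longrightarrow> \<omega> \<in> space Pr \<Longrightarrow>
         sps_step a b M dt C1 C2 e1 e2
           (\<lambda>k. B k (real n * dt) \<omega> - B k (real (n - 1) * dt) \<omega>)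
           (P (n - 1) \<omega>) (Q (n - 1) \<omega>) (U (n - 1) \<omega>) (V (n - 1) \<omega>)
           (P n \<omega>) (Q n \<omega>) (U n \<omega>) (V n \<omega>)"
  shows "\<forall>n\<in>{0..N}.
      integrable Pr (\<lambda>\<omega>. charge a b M (P n \<omega>) (Q n \<omega>)) \<and>
      integrable Pr (\<lambda>\<omega>. energy a b M (P n \<omega>) (Q n \<omega>) (U n \<omega>) (V n \<omega>)) \<and>
      integrable Pr (\<lambda>\<omega>. inner_h a b M (U n \<omega>) (e1 \<odot> e1)) \<and>
      prob_space.expectation Pr (\<lambda>\<omega>. charge a b M (P n \<omega>) (Q n \<omega>)) =
        prob_space.expectation Pr (\<lambda>\<omega>. charge a b M (P 0 \<omega>) (Q 0 \<omega>))
        + 2 * C1\<^sup>2 * (norm_h a b M e1)\<^sup>2 * (real n * dt) \<and>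
      prob_space.expectation Pr (\<lambda>\<omega>. energy a b M (P n \<omega>) (Q n \<omega>) (U n \<omega>) (V n \<omega>)) =
        prob_space.expectation Pr (\<lambda>\<omega>. energy a b M (P 0 \<omega>) (Q 0 \<omega>) (U 0 \<omega>) (V 0 \<omega>))
        - C2\<^sup>2 * (norm_h a b M e2)\<^sup>2 * (real n * dt)
        + 4 * C1\<^sup>2 * inner_h a b M e1 (A e1) * (real n * dt)
        + 4 * C1\<^sup>2 * (\<Sum>i<n. prob_space.expectation Pr (\<lambda>\<omega>. inner_h a b M (U i \<omega>) (e1 \<odot> e1)) * dt)"
proof -
  let ?I = "{1..M - 1}"
  let ?X0 = "\<lambda>\<omega>. (restrict (P 0 \<omega>) ?I, restrict (Q 0 \<omega>) ?I, restrict (U 0 \<omega>) ?I, restrict (V 0 \<omega>) ?I)"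
  define X where "X = vimage_algebra (space Pr) ?X0 (S \<Otimes>\<^sub>M S \<Otimes>\<^sub>M S \<Otimes>\<^sub>M S)"
  \<comment> \<open>One extra increment keeps the noise family nonempty when \<open>N = 0\<close>.\<close>
  interpret noise_filtration Pr X "\<lambda>k m \<omega>. B k (real (Suc m) * dt) \<omega> - B k (real m * dt) \<omega>" "Suc N" dt
    by (rule std_wiener_noise_filtration[OF prob wiener wiener_indep _ _ dt])
      (use init_indep in \<open>simp_all add: X_def\<close>)
  have subPr: "f \<in> borel_measurable Pr" if "f \<in> borel_measurable (filtration n)" "n \<le> N" for f :: "'w \<Rightarrow> real" and n
    by (rule measurable_from_subalg[OF filtration_subalgebra that(1)]) (use that(2) in simp)
  \<comment> \<open>Adaptedness and the moment class travel with the two laws, since the balance of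
    each step uses them at the old level.\<close>
  let ?regular = "\<lambda>n. \<forall>i\<in>?I.
      (\<lambda>\<omega>. P n \<omega> i) \<in> borel_measurable (filtration n) \<and> (\<lambda>\<omega>. Q n \<omega> i) \<in> borel_measurable (filtration n) \<and>
      (\<lambda>\<omega>. U n \<omega> i) \<in> borel_measurable (filtration n) \<and> (\<lambda>\<omega>. V n \<omega> i) \<in> borel_measurable (filtration n) \<and>
      square_integrable Pr (\<lambda>\<omega>. (P n \<omega> i)\<^sup>2) \<and> square_integrable Pr (\<lambda>\<omega>. (Q n \<omega> i)\<^sup>2) \<and>
      square_integrable Pr (\<lambda>\<omega>. U n \<omega> i) \<and> square_integrable Pr (\<lambda>\<omega>. V n \<omega> i)"
  let ?charge = "\<lambda>n. expectation (\<lambda>\<omega>. charge a b M (P n \<omega>) (Q n \<omega>))"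
  let ?energy = "\<lambda>n. expectation (\<lambda>\<omega>. energy a b M (P n \<omega>) (Q n \<omega>) (U n \<omega>) (V n \<omega>))"
  let ?inner = "\<lambda>n. expectation (\<lambda>\<omega>. inner_h a b M (U n \<omega>) (e1 \<odot> e1))"
  have start: "?regular 0"
  proof
    fix i assume i: "i \<in> ?I"
    \<comment> \<open>\<open>X\<close> is generated by the restricted initial vectors; an entry is
      recovered by a projection followed by evaluation at \<open>i\<close>.\<close>
    have "?X0 \<in> measurable X (S \<Otimes>\<^sub>M S \<Otimes>\<^sub>M S \<Otimes>\<^sub>M S)"
      unfolding X_def by (rule measurable_vimage_algebra1) (auto simp: S_def space_pair_measure space_PiM)
    hence X0: "?X0 \<in> measurable (filtration 0) (S \<Otimes>\<^sub>M S \<Otimes>\<^sub>M S \<Otimes>\<^sub>M S)"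
      by (rule filtration_start)
    have comp: "(\<lambda>x. x i) \<in> borel_measurable S"
      unfolding S_def using i by (rule measurable_component_singleton)
    have "(\<lambda>\<omega>. restrict (P 0 \<omega>) ?I i) \<in> borel_measurable (filtration 0)"
      "(\<lambda>\<omega>. restrict (Q 0 \<omega>) ?I i) \<in> borel_measurable (filtration 0)"
      "(\<lambda>\<omega>. restrict (U 0 \<omega>) ?I i) \<in> borel_measurable (filtration 0)"
      "(\<lambda>\<omega>. restrict (V 0 \<omega>) ?I i) \<in> borel_measurable (filtration 0)"
      using measurable_compose[OF measurable_compose[OF X0 measurable_fst] comp]
        measurable_compose[OF measurable_compose[OF measurable_compose[OF X0 measurable_snd] measurable_fst] comp]
        measurable_compose[OF measurable_compose[OF measurable_compose[OF measurable_compose[OF X0 measurable_snd] measurable_snd] measurable_fst] comp]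
        measurable_compose[OF measurable_compose[OF measurable_compose[OF measurable_compose[OF X0 measurable_snd] measurable_snd] measurable_snd] comp]
      by simp_all
    hence m: "(\<lambda>\<omega>. P 0 \<omega> i) \<in> borel_measurable (filtration 0)" "(\<lambda>\<omega>. Q 0 \<omega> i) \<in> borel_measurable (filtration 0)"
      "(\<lambda>\<omega>. U 0 \<omega> i) \<in> borel_measurable (filtration 0)" "(\<lambda>\<omega>. V 0 \<omega> i) \<in> borel_measurable (filtration 0)"
      using i by simp_all
    show "(\<lambda>\<omega>. P 0 \<omega> i) \<in> borel_measurable (filtration 0) \<and> (\<lambda>\<omega>. Q 0 \<omega> i) \<in> borel_measurable (filtration 0) \<and>
      (\<lambda>\<omega>. U 0 \<omega> i) \<in> borel_measurable (filtration 0) \<and> (\<lambda>\<omega>. V 0 \<omega> i) \<in> borel_measurable (filtration 0) \<and>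
      square_integrable Pr (\<lambda>\<omega>. (P 0 \<omega> i)\<^sup>2) \<and> square_integrable Pr (\<lambda>\<omega>. (Q 0 \<omega> i)\<^sup>2) \<and>
      square_integrable Pr (\<lambda>\<omega>. U 0 \<omega> i) \<and> square_integrable Pr (\<lambda>\<omega>. V 0 \<omega> i)"
      using m m[THEN subPr] init_moments[OF i] by (simp add: square_integrable_def power_mult[symmetric])
  qed
  have state: "sps_state Pr a b M (P n) (Q n) (U n) (V n)" if "?regular n" "n \<le> N" for n
    using that(1) ab by unfold_locales (auto intro: subPr[OF _ that(2)])
  have update: "?regular (Suc n) \<and> ?charge (Suc n) = ?charge n + 2 * C1\<^sup>2 * (norm_h a b M e1)\<^sup>2 * dt \<and>
      ?energy (Suc n) = ?energy n - C2\<^sup>2 * (norm_h a b M e2)\<^sup>2 * dt + 4 * C1\<^sup>2 * inner_h a b M e1 (A e1) * dt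
        + 4 * C1\<^sup>2 * (?inner n * dt)"
    if n: "n < N" and reg: "?regular n" for n
  proof -
    \<comment> \<open>The scheme counts steps from 1 and the filtration counts increments from 0:
      equation \<open>Suc n\<close> uses increment \<open>n\<close>.\<close>
    interpret s: sps_noise_step Pr "filtration n" "filtration (Suc n)"
      "\<lambda>k \<omega>. B k (real (Suc n) * dt) \<omega> - B k (real n * dt) \<omega>"
      "\<lambda>l. integral\<^sup>L lborel (\<lambda>x. normal_density 0 (sqrt dt) x * x ^ l)" dt a b M
      "P n" "Q n" "U n" "V n" C1 C2 e1 e2 "P (Suc n)" "Q (Suc n)" "U (Suc n)" "V (Suc n)"
      by (intro sps_noise_step.intro noise_step_at state reg sps_noise_step_axioms.intro dt)
        (use n reg scheme[of "Suc n"] in auto)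
    show ?thesis
      using s.P_measurable s.Q_measurable s.U_measurable s.V_measurable s.new_square_integrable
        s.U_square_integrable s.V_square_integrable
        has_bochner_integral_integral_eq[OF s.charge_increment]
        has_bochner_integral_integral_eq[OF s.energy_increment]
      by (simp add: A_def)
  qed
  have laws: "?regular n \<and> ?charge n = ?charge 0 + 2 * C1\<^sup>2 * (norm_h a b M e1)\<^sup>2 * (real n * dt) \<and>
      ?energy n = ?energy 0 - C2\<^sup>2 * (norm_h a b M e2)\<^sup>2 * (real n * dt)
        + 4 * C1\<^sup>2 * inner_h a b M e1 (A e1) * (real n * dt) + 4 * C1\<^sup>2 * (\<Sum>i<n. ?inner i * dt)"
    if "n \<le> N" for n
    using that
  proof (induction n)
    case 0 show ?case using start by simp
  next
    case (Suc n)
    hence IH: "?regular n" "?charge n = ?charge 0 + 2 * C1\<^sup>2 * (norm_h a b M e1)\<^sup>2 * (real n * dt)"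
      "?energy n = ?energy 0 - C2\<^sup>2 * (norm_h a b M e2)\<^sup>2 * (real n * dt)
        + 4 * C1\<^sup>2 * inner_h a b M e1 (A e1) * (real n * dt) + 4 * C1\<^sup>2 * (\<Sum>i<n. ?inner i * dt)"
      by auto
    have n: "n < N" using Suc.prems by simp
    note up = update[OF n IH(1)]
    have "?charge (Suc n) = ?charge 0 + 2 * C1\<^sup>2 * (norm_h a b M e1)\<^sup>2 * (real (Suc n) * dt)"
      using up[THEN conjunct2, THEN conjunct1] unfolding IH(2) by (simp add: algebra_simps)
    moreover have "?energy (Suc n) = ?energy 0 - C2\<^sup>2 * (norm_h a b M e2)\<^sup>2 * (real (Suc n) * dt)
        + 4 * C1\<^sup>2 * inner_h a b M e1 (A e1) * (real (Suc n) * dt) + 4 * C1\<^sup>2 * (\<Sum>i<Suc n. ?inner i * dt)"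
      using up[THEN conjunct2, THEN conjunct2] unfolding IH(3) by (simp add: algebra_simps)
    ultimately show ?case using up[THEN conjunct1] by blast
  qed
  show ?thesis
  proof
    fix n assume "n \<in> {0..N}"
    hence n: "n \<le> N" by simp
    note l = laws[OF n]
    interpret s: sps_state Pr a b M "P n" "Q n" "U n" "V n"
      by (rule state[OF conjunct1[OF l] n])
    \<comment> \<open>The Bochner integral of a non-integrable function is 0 by convention, so
      integrability is what makes the two laws statements about averages.\<close>
    have "integrable Pr (\<lambda>\<omega>. charge a b M (P n \<omega>) (Q n \<omega>))"
      by (intro charge_integrable s.old_linear ab)
    moreover have "integrable Pr (\<lambda>\<omega>. energy a b M (P n \<omega>) (Q n \<omega>) (U n \<omega>) (V n \<omega>))"
      "integrable Pr (\<lambda>\<omega>. inner_h a b M (U n \<omega>) (e1 \<odot> e1))"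
      by (rule integrable.intros[OF s.energy_old_integral], rule integrable.intros[OF s.inner_old_integral])
    ultimately show "integrable Pr (\<lambda>\<omega>. charge a b M (P n \<omega>) (Q n \<omega>)) \<and>
      integrable Pr (\<lambda>\<omega>. energy a b M (P n \<omega>) (Q n \<omega>) (U n \<omega>) (V n \<omega>)) \<and>
      integrable Pr (\<lambda>\<omega>. inner_h a b M (U n \<omega>) (e1 \<odot> e1)) \<and>
      ?charge n = ?charge 0 + 2 * C1\<^sup>2 * (norm_h a b M e1)\<^sup>2 * (real n * dt) \<and>
      ?energy n = ?energy 0 - C2\<^sup>2 * (norm_h a b M e2)\<^sup>2 * (real n * dt)
        + 4 * C1\<^sup>2 * inner_h a b M e1 (A e1) * (real n * dt) + 4 * C1\<^sup>2 * (\<Sum>i<n. ?inner i * dt)"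
      using l by blast
  qed
qed

end
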